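(* Let $\lambda,\nu>0$, $W\ge 0$, and consider the single-content average latency problem $$\min_{\pi}\ \limsup_{T\to\infty}\frac1T\,\mathbb{E}_{\pi}\left[\int_0^T\big(S_t-W(1-A_t)\big)\,dt\right],$$ for the controlled continuous-time Markov process $(S_t)$ on $\{0,1,\dots,S_{max}\}$ with actions $A_t\in\{0,1\}$, where in state $s$ under action $a$ the process jumps to $s+1$ at rate $\lambda$ (if $s<S_{max}$) and to $s-1$ at rate $\nu s a$. There exists an optimal stationary policy of the threshold type for this problem.
   Context: The state is the number of outstanding requests for a content; $a=1$ (active) means the content is cached, $a=0$ (passive) means it is not. $W$ is a fixed Lagrange multiplier. Decisions are made at the times at which the state changes. The state is assumed to be bounded by $S_{max}$, which can be arbitrarily large but finite. A stationary deterministic policy is of threshold type if there is $R\in\{-1,0,1,\dots,S_{max}\}$ such that the policy chooses $a=0$ in all states $s\le R$ and $a=1$ in all states $s>R$. *)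

theory Defs
  imports "HOL-Probability.Probability"
begin

definition up_rate :: "nat \<Rightarrow> real \<Rightarrow> nat \<Rightarrow> real" where
  "up_rate Smax lam s = (if s < Smax then lam else 0)"

definition down_rate :: "real \<Rightarrow> nat \<Rightarrow> bool \<Rightarrow> real" where
  "down_rate nu s a = nu * real s * of_bool a"

definition exit_rate :: "nat \<Rightarrow> real \<Rightarrow> real \<Rightarrow> nat \<Rightarrow> bool \<Rightarrow> real" where
  "exit_rate Smax lam nu s a = up_rate Smax lam s + down_rate nu s a"

text \<open>The exit rate vanishes in state \<open>Smax\<close> under the passive action. The process then stays
  there forever: the sojourn time is infinite, and the state recorded at later decision epochs is
  irrelevant.\<close>

definition jump_pmf :: "nat \<Rightarrow> real \<Rightarrow> real \<Rightarrow> nat \<Rightarrow> bool \<Rightarrow> nat pmf" where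
  "jump_pmf Smax lam nu s a =
     (if exit_rate Smax lam nu s a = 0 then return_pmf s
      else map_pmf (\<lambda>up. if up then s + 1 else s - 1)
             (bernoulli_pmf (up_rate Smax lam s / exit_rate Smax lam nu s a)))"

definition sojourn :: "real \<Rightarrow> ennreal measure" where
  "sojourn r = (if r = 0 then return borel \<infinity>
                else distr (density lborel (exponential_density r)) borel ennreal)"

text \<open>A record consists of the state entered at a decision epoch (time \<open>0\<close> or a jump time), the
  action chosen there, and the length of the sojourn that follows.\<close>

type_synonym epoch_record = "nat \<times> bool \<times> ennreal"

definition record_space :: "epoch_record measure" where
  "record_space = count_space UNIV \<Otimes>\<^sub>M (count_space UNIV \<Otimes>\<^sub>M borel)"

text \<open>A policy may be randomised and history dependent: \<open>\<pi> n h s\<close> is the probability of the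
  active action at the \<open>n\<close>-th decision epoch, given the records \<open>h k\<close>, \<open>k < n\<close>, of the earlier
  epochs and the current state \<open>s\<close>.\<close>

type_synonym policy = "nat \<Rightarrow> (nat \<Rightarrow> epoch_record) \<Rightarrow> nat \<Rightarrow> real"

definition admissible :: "policy \<Rightarrow> bool" where
  "admissible \<pi> \<longleftrightarrow>
     (\<forall>n s. (\<lambda>h. \<pi> n h s) \<in> borel_measurable (Pi\<^sub>M {0..<n} (\<lambda>_. record_space)) \<and>
            (\<forall>h\<in>space (Pi\<^sub>M {0..<n} (\<lambda>_. record_space)). \<pi> n h s \<in> {0..1}))"

definition stationary :: "(nat \<Rightarrow> bool) \<Rightarrow> policy" where
  "stationary f = (\<lambda>n h s. of_bool (f s))"

definition threshold_type :: "nat \<Rightarrow> (nat \<Rightarrow> bool) \<Rightarrow> bool" where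
  "threshold_type Smax f \<longleftrightarrow>
     (\<exists>R::int. R \<in> {-1..int Smax} \<and> (\<forall>s\<le>Smax. f s \<longleftrightarrow> int s > R))"

definition next_state :: "nat \<Rightarrow> real \<Rightarrow> real \<Rightarrow> nat \<Rightarrow> nat \<Rightarrow> (nat \<Rightarrow> epoch_record) \<Rightarrow> nat pmf" where
  "next_state Smax lam nu s0 n h =
     (case n of 0 \<Rightarrow> return_pmf s0
      | Suc k \<Rightarrow> jump_pmf Smax lam nu (fst (h k)) (fst (snd (h k))))"

definition kernel ::
    "nat \<Rightarrow> real \<Rightarrow> real \<Rightarrow> policy \<Rightarrow> nat \<Rightarrow> nat \<Rightarrow> (nat \<Rightarrow> epoch_record) \<Rightarrow> epoch_record measure" where
  "kernel Smax lam nu \<pi> s0 n h =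
     measure_pmf (next_state Smax lam nu s0 n h) \<bind> (\<lambda>s.
     measure_pmf (bernoulli_pmf (\<pi> n h s)) \<bind> (\<lambda>a.
     distr (sojourn (exit_rate Smax lam nu s a)) record_space (\<lambda>\<tau>. (s, a, \<tau>))))"

text \<open>The law of the infinite sequence of records, from the Ionescu-Tulcea theorem.\<close>

definition path_measure ::
    "nat \<Rightarrow> real \<Rightarrow> real \<Rightarrow> policy \<Rightarrow> nat \<Rightarrow> (nat \<Rightarrow> epoch_record) measure" where
  "path_measure Smax lam nu \<pi> s0 =
     projective_family.lim UNIV
       (Ionescu_Tulcea.CI (kernel Smax lam nu \<pi> s0) (\<lambda>_. record_space)) (\<lambda>_. record_space)"

text \<open>The number of jumps up to time \<open>t\<close>. The \<open>LEAST\<close> exists on all paths without explosion, hence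
  almost surely.\<close>

definition epoch :: "(nat \<Rightarrow> epoch_record) \<Rightarrow> real \<Rightarrow> nat" where
  "epoch \<omega> t = (LEAST n. ennreal t < (\<Sum>k\<le>n. snd (snd (\<omega> k))))"

definition state_at :: "(nat \<Rightarrow> epoch_record) \<Rightarrow> real \<Rightarrow> nat" where
  "state_at \<omega> t = fst (\<omega> (epoch \<omega> t))"

definition action_at :: "(nat \<Rightarrow> epoch_record) \<Rightarrow> real \<Rightarrow> bool" where
  "action_at \<omega> t = fst (snd (\<omega> (epoch \<omega> t)))"

definition average_cost ::
    "nat \<Rightarrow> real \<Rightarrow> real \<Rightarrow> real \<Rightarrow> policy \<Rightarrow> nat \<Rightarrow> ereal" where
  "average_cost Smax lam nu W \<pi> s0 =
     Limsup at_top (\<lambda>T::real. ereal (1 / T *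
       (\<integral>\<omega>. (LBINT t:{0..T}. real (state_at \<omega> t) - W * (1 - of_bool (action_at \<omega> t)))
          \<partial>path_measure Smax lam nu \<pi> s0)))"

definition optimal :: "nat \<Rightarrow> real \<Rightarrow> real \<Rightarrow> real \<Rightarrow> policy \<Rightarrow> bool" where
  "optimal Smax lam nu W \<pi> \<longleftrightarrow> admissible \<pi> \<and>
     (\<forall>s0\<le>Smax. \<forall>\<pi>'. admissible \<pi>' \<longrightarrow>
        average_cost Smax lam nu W \<pi> s0 \<le> average_cost Smax lam nu W \<pi>' s0)"

text \<open>The construction is well defined: the kernels satisfy the hypotheses of the Ionescu-Tulcea
  theorem for every admissible policy.\<close>

lemma admissible_stationary: "admissible (stationary f)"
  by (auto simp: admissible_def stationary_def)

lemma prob_space_sojourn: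
  assumes "r \<ge> 0" shows "prob_space (sojourn r)"
proof (cases "r = 0")
  case False
  then interpret prob_space "density lborel (exponential_density r)"
    using assms by (intro prob_space_exponential_density) simp
  show ?thesis using False by (auto simp: sojourn_def intro!: prob_space_distr)
qed (auto simp: sojourn_def intro!: prob_space_return)

lemma sets_sojourn [measurable_cong, simp]: "sets (sojourn r) = sets borel"
  by (simp add: sojourn_def)

lemma record_measurable [measurable]: "(\<lambda>\<tau>. (s, a, \<tau>)) \<in> borel \<rightarrow>\<^sub>M record_space"
  unfolding record_space_def by measurable

lemma fst_record_measurable [measurable]: "fst \<in> record_space \<rightarrow>\<^sub>M count_space UNIV"
  unfolding record_space_def by measurable

lemma fst_snd_record_measurable [measurable]:
  "(\<lambda>x. fst (snd x)) \<in> record_space \<rightarrow>\<^sub>M count_space UNIV"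
  unfolding record_space_def by measurable

lemma exit_rate_nonneg: "lam > 0 \<Longrightarrow> nu > 0 \<Longrightarrow> exit_rate Smax lam nu s a \<ge> 0"
  by (simp add: exit_rate_def up_rate_def down_rate_def)

lemma prob_space_record:
  assumes "lam > 0" "nu > 0"
  shows "prob_space (distr (sojourn (exit_rate Smax lam nu s a)) record_space (\<lambda>\<tau>. (s, a, \<tau>)))"
  by (intro prob_space.prob_space_distr prob_space_sojourn exit_rate_nonneg assms) simp

lemma measurable_bernoulli_pmf:
  assumes [measurable]: "p \<in> borel_measurable M"
  shows "(\<lambda>x. measure_pmf (bernoulli_pmf (p x))) \<in> M \<rightarrow>\<^sub>M subprob_algebra (count_space UNIV)"
proof (rule measurable_subprob_algebra)
  fix A :: "bool set"
  have "emeasure (measure_pmf (bernoulli_pmf (p x))) A =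
     (\<Sum>b\<in>A. ennreal (if b then min 1 (max 0 (p x)) else 1 - min 1 (max 0 (p x))))" for x
    by (subst emeasure_measure_pmf_finite)
       (auto intro!: sum.cong simp: bernoulli_pmf.rep_eq)
  then show "(\<lambda>x. emeasure (measure_pmf (bernoulli_pmf (p x))) A) \<in> borel_measurable M"
    by simp
qed (auto intro: measure_pmf.subprob_space_axioms)

lemma Ionescu_Tulcea_kernel:
  assumes "lam > 0" "nu > 0" "admissible \<pi>"
  shows "Ionescu_Tulcea (kernel Smax lam nu \<pi> s0) (\<lambda>_. record_space)"
proof (rule Ionescu_Tulcea.intro)
  fix n :: nat
  let ?H = "Pi\<^sub>M {0..<n} (\<lambda>_. record_space)"
  let ?D = "\<lambda>s a. distr (sojourn (exit_rate Smax lam nu s a)) record_space (\<lambda>\<tau>. (s, a, \<tau>))"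
  have D: "?D s a \<in> space (prob_algebra record_space)" for s a
    using prob_space_record[OF assms(1,2)] by (simp add: space_prob_algebra)
  have \<pi> [measurable]: "(\<lambda>h. \<pi> n h s) \<in> borel_measurable ?H" for s
    using assms(3) by (simp add: admissible_def)
  have N: "(\<lambda>h. measure_pmf (next_state Smax lam nu s0 n h)) \<in> ?H \<rightarrow>\<^sub>M prob_algebra (count_space UNIV)"
  proof (cases n)
    case 0
    then show ?thesis
      by (simp add: next_state_def space_prob_algebra measure_pmf.prob_space_axioms)
  next
    case (Suc k)
    have [measurable]: "(\<lambda>h. h k) \<in> ?H \<rightarrow>\<^sub>M record_space"
      using Suc by (intro measurable_component_singleton) auto
    have c: "(\<lambda>h. (fst (h k), fst (snd (h k)))) \<in> ?H \<rightarrow>\<^sub>M count_space UNIV \<Otimes>\<^sub>M count_space UNIV"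
      by measurable
    then have c': "(\<lambda>h. (fst (h k), fst (snd (h k)))) \<in> ?H \<rightarrow>\<^sub>M count_space UNIV"
      by (simp add: pair_measure_countable)
    have "(\<lambda>(s, a). measure_pmf (jump_pmf Smax lam nu s a)) \<in>
        count_space UNIV \<rightarrow>\<^sub>M prob_algebra (count_space UNIV)"
      by (auto simp: space_prob_algebra measure_pmf.prob_space_axioms)
    from measurable_compose[OF c' this] show ?thesis
      using Suc by (simp add: next_state_def)
  qed
  have B: "(\<lambda>h. measure_pmf (bernoulli_pmf (\<pi> n h s))) \<in> ?H \<rightarrow>\<^sub>M prob_algebra (count_space UNIV)" for s
    by (intro measurable_prob_algebraI measurable_bernoulli_pmf \<pi> measure_pmf.prob_space_axioms)
  have I: "(\<lambda>h. measure_pmf (bernoulli_pmf (\<pi> n h s)) \<bind> ?D s) \<in> ?H \<rightarrow>\<^sub>M prob_algebra record_space" for s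
    by (rule measurable_bind_prob_space[OF B]) (use D in auto)
  have I2: "(\<lambda>(h, s). measure_pmf (bernoulli_pmf (\<pi> n h s)) \<bind> ?D s)
      \<in> ?H \<Otimes>\<^sub>M count_space UNIV \<rightarrow>\<^sub>M prob_algebra record_space"
    unfolding split_def
    by (rule measurable_compose_countable'[where I=UNIV and g=snd
          and f="\<lambda>s x. measure_pmf (bernoulli_pmf (\<pi> n (fst x) s)) \<bind> ?D s"])
       (auto intro!: measurable_compose[OF measurable_fst I])
  have K: "kernel Smax lam nu \<pi> s0 n \<in> ?H \<rightarrow>\<^sub>M prob_algebra record_space"
    unfolding kernel_def
    by (rule measurable_bind_prob_space2[OF N I2])
  show "kernel Smax lam nu \<pi> s0 n \<in> ?H \<rightarrow>\<^sub>M subprob_algebra record_space"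
    using K by (rule measurable_prob_algebraD)
  fix h assume "h \<in> space ?H"
  with K show "prob_space (kernel Smax lam nu \<pi> s0 n h)"
    by (auto dest: measurable_space simp: space_prob_algebra)
qed

lemma prob_space_path_measure:
  assumes "lam > 0" "nu > 0" "admissible \<pi>"
  shows "prob_space (path_measure Smax lam nu \<pi> s0)"
proof -
  interpret Ionescu_Tulcea "kernel Smax lam nu \<pi> s0" "\<lambda>_. record_space"
    by (rule Ionescu_Tulcea_kernel[OF assms])
  have "prob_space (distr PF.lim (Pi\<^sub>M {} (\<lambda>_. record_space)) (\<lambda>x. restrict x {}))"
    by (subst distr_lim) (auto intro: PF.prob_space_P)
  then show ?thesis
    unfolding path_measure_def
    by (rule prob_space_distrD[rotated])
       (simp add: measurable_cong_sets[OF PF.sets_lim refl] measurable_restrict_subset)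
qed

end

theory Submission
  imports Defs
begin

text \<open>Dynkin's formula holds along every admissible policy: at each jump the conditional law of the
  sojourn and of the next state turns sums over jumps into time integrals of the generator, and the
  bounded exit rates rule out explosion. Hence a solution \<open>(g, h)\<close> of the average-cost optimality
  equation makes \<open>g\<close> a lower bound for all policies. The optimality equation need not have a
  minimiser of threshold type: for large \<open>lam\<close> the passive action may be optimal again in high
  states. But if \<open>R\<close> is the largest state in which the passive action is minimising, then under
  the threshold policy at \<open>R\<close> all states below \<open>R\<close> are transient, so \<open>h\<close> can be modified there and
  the policy still attains \<open>g\<close>.\<close>

text \<open>Competing policies may use the whole past, so the state process need not be Markov; only
  the law of one record given the earlier ones is available. Integrals stay in
  \<open>ennreal\<close> as long as possible: \<open>Smax\<close> under the passive action is
  absorbing, so sojourns can be infinite, and truncating all jump times at a finite horizon makes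
  every later record contribute zero.

  The optimality equation needs no general existence theory. Jumps have size one, so only
  differences of \<open>h\<close> enter; for a given gain they obey a first-order recursion, and one
  scalar equation for the gain is left to the intermediate value theorem.

  Why the minimiser can return to passive: while the maximum in the recursion is \<open>W\<close>,
  the gain \<open>Smax - W\<close> gives \<open>marginal\<close> the value
  \<open>nu * s * (Smax - s + 1) / lam\<close>, a parabola that falls again towards
  \<open>Smax\<close>. For \<open>Smax \<ge> 3\<close>, a \<open>W\<close> slightly below its peak
  makes caching attractive in middle states only.\<close>

subsection \<open>One-step identities\<close>

text \<open>Layer cake: \<open>min x u\<close> is the integral of \<open>v < x\<close> over \<open>v\<close> in \<open>{0..u}\<close>, and \<open>r\<close> times the tail of
  the exponential distribution is its density.\<close>

lemma nn_integral_exponential_min: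
  assumes r: "r > 0" and u: "u \<ge> 0"
  shows "(\<integral>\<^sup>+x. indicator {..u} x \<partial>density lborel (exponential_density r)) =
    ennreal r * (\<integral>\<^sup>+x. ennreal (min (max 0 x) u) \<partial>density lborel (exponential_density r))"
proof -
  let ?D = "density lborel (exponential_density r)"
  interpret D: prob_space ?D by (rule prob_space_exponential_density[OF r])
  interpret pair_sigma_finite ?D lborel ..
  have dist: "distributed ?D lborel (\<lambda>x. x) (exponential_density r)"
    by (auto simp: distributed_def intro!: distr_id2)
  have tail: "emeasure ?D {v<..} = ennreal (exp (- v * r))" if "v \<ge> 0" for v
    using D.exponential_distributedD_gt[OF dist that] r by (simp add: D.emeasure_eq_measure greaterThan_def)
  have tail': "(\<integral>\<^sup>+x. (if v < x then 1 else 0) \<partial>?D) = ennreal (exp (- v * r))" if "v \<ge> 0" for v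
  proof -
    have "(\<integral>\<^sup>+x. (if v < x then 1 else 0) \<partial>?D) = (\<integral>\<^sup>+x. indicator {v<..} x \<partial>?D)"
      by (intro nn_integral_cong) (auto simp: indicator_def)
    then show ?thesis using tail[OF that] by simp
  qed
  have len: "ennreal (min (max 0 x) u) = (\<integral>\<^sup>+v. indicator {0..u} v * (if v < x then 1 else 0) \<partial>lborel)" for x :: real
  proof -
    \<comment> \<open>The condition \<open>v < x\<close> is strict at \<open>v = x\<close>, and the
      closed interval contains \<open>0\<close> even when \<open>x \<le> 0\<close>; both points are
      null.\<close>
    have "(\<integral>\<^sup>+v. indicator {0..u} v * (if v < x then 1 else 0) \<partial>lborel) =
       (\<integral>\<^sup>+v. indicator {0..min (max 0 x) u} v \<partial>lborel)"
      by (rule nn_integral_cong_AE, rule AE_mp[OF AE_lborel_singleton[of x]])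
         (rule AE_mp[OF AE_lborel_singleton[of 0]], auto simp: indicator_def)
    also have "\<dots> = ennreal (min (max 0 x) u)"
      using u by (subst nn_integral_indicator) auto
    finally show ?thesis ..
  qed
  have "(\<integral>\<^sup>+x. ennreal (min (max 0 x) u) \<partial>?D) =
      (\<integral>\<^sup>+v. (\<integral>\<^sup>+x. indicator {0..u} v * (if v < x then 1 else 0) \<partial>?D) \<partial>lborel)"
    unfolding len
    by (rule Fubini'[symmetric]) (measurable)
  also have "\<dots> = (\<integral>\<^sup>+v. indicator {0..u} v * ennreal (exp (- v * r)) \<partial>lborel)"
    by (intro nn_integral_cong) (auto simp: nn_integral_cmult tail' indicator_def)
  finally have "ennreal r * (\<integral>\<^sup>+x. ennreal (min (max 0 x) u) \<partial>?D) =
     (\<integral>\<^sup>+v. ennreal r * (indicator {0..u} v * ennreal (exp (- v * r))) \<partial>lborel)"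
    by (simp add: nn_integral_cmult)
  also have "\<dots> = (\<integral>\<^sup>+v. ennreal (exponential_density r v) * indicator {..u} v \<partial>lborel)"
    using r by (intro nn_integral_cong)
       (auto simp: exponential_density_def indicator_def ennreal_mult'[symmetric] mult_ac)
  also have "\<dots> = (\<integral>\<^sup>+x. indicator {..u} x \<partial>?D)"
    by (subst nn_integral_density) auto
  finally show ?thesis ..
qed

text \<open>The constant hazard rate of the exponential law: the chance that the sojourn ends by
  \<open>T\<close> is \<open>r\<close> times its expected part before \<open>T\<close>. Here
  \<open>t\<close> is the time already elapsed; beyond \<open>T\<close> both sides vanish, as they
  do for \<open>r = 0\<close>, where the sojourn is infinite.\<close>

lemma nn_integral_sojourn:
  fixes t :: ennreal
  assumes r: "r \<ge> 0" and T: "T \<ge> 0"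
  shows "(\<integral>\<^sup>+x. indicator {..ennreal T} (t + x) \<partial>sojourn r) =
    ennreal r * (\<integral>\<^sup>+x. min (t + x) (ennreal T) - min t (ennreal T) \<partial>sojourn r)"
proof (cases "r = 0")
  case True
  then show ?thesis by (simp add: sojourn_def nn_integral_return top_unique)
next
  case False
  with r have r: "r > 0" by simp
  show ?thesis
  proof (cases "t \<le> ennreal T")
    case False
    then have "\<not> t + x \<le> ennreal T" for x
      by (meson order_trans le_add_same_cancel1 zero_le add_increasing2 order_refl)
    moreover have "min (t + x) (ennreal T) = ennreal T" for x
      using calculation[of x] by (simp add: min_def)
    ultimately show ?thesis using False by (simp add: min_def)
  next
    case True
    then obtain t' where t': "t = ennreal t'" "t' \<ge> 0" "t' \<le> T"
      using T by (cases t) (auto simp: top_unique)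
    have a: "indicator {..ennreal T} (t + ennreal x) = (indicator {..T - t'} x :: ennreal)" if "x \<ge> 0" for x
      using t' that T by (auto simp: indicator_def ennreal_plus[symmetric] simp del: ennreal_plus)
    have b: "min (t + ennreal x) (ennreal T) - min t (ennreal T) = ennreal (min (max 0 x) (T - t'))" if "x \<ge> 0" for x
      using t' that T by (auto simp: min_def ennreal_plus[symmetric] ennreal_minus simp del: ennreal_plus)
    have AE: "AE x in density lborel (exponential_density r). x \<ge> 0"
      using r by (subst AE_density) (auto simp: exponential_density_def)
    have "(\<integral>\<^sup>+x. indicator {..ennreal T} (t + x) \<partial>sojourn r) =
        (\<integral>\<^sup>+x. indicator {..ennreal T} (t + ennreal x) \<partial>density lborel (exponential_density r))"
      using \<open>r \<noteq> 0\<close> by (simp add: sojourn_def nn_integral_distr)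
    also have "\<dots> = (\<integral>\<^sup>+x. indicator {..T - t'} x \<partial>density lborel (exponential_density r))"
      using AE by (intro nn_integral_cong_AE) (auto elim!: eventually_mono simp: a)
    also have "\<dots> = ennreal r * (\<integral>\<^sup>+x. ennreal (min (max 0 x) (T - t')) \<partial>density lborel (exponential_density r))"
      using t' r by (intro nn_integral_exponential_min) auto
    also have "(\<integral>\<^sup>+x. ennreal (min (max 0 x) (T - t')) \<partial>density lborel (exponential_density r)) =
       (\<integral>\<^sup>+x. min (t + ennreal x) (ennreal T) - min t (ennreal T) \<partial>density lborel (exponential_density r))"
      using AE by (intro nn_integral_cong_AE) (auto elim!: eventually_mono simp: b)
    also have "\<dots> = (\<integral>\<^sup>+x. min (t + x) (ennreal T) - min t (ennreal T) \<partial>sojourn r)"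
      using \<open>r \<noteq> 0\<close> by (simp add: sojourn_def nn_integral_distr)
    finally show ?thesis .
  qed
qed

section \<open>Integrating out the last record of a finite path\<close>

lemma (in Ionescu_Tulcea) CI_atLeastLessThan: "CI {0..<n} = C 0 n (\<lambda>_. undefined)"
proof -
  have "CI {0..<n} = distr (C 0 n (\<lambda>_. undefined)) (PiM {0..<n} M) (\<lambda>f. restrict f {0..<n})"
  proof -
    have "up_to {0..<n} = n"
      by (rule antisym) (use up_to[of "{0..<n}"] up_to_iff[of "{0..<n}" n] in auto)
    then show ?thesis by (simp add: CI_def)
  qed
  also have "\<dots> = distr (C 0 n (\<lambda>_. undefined)) (PiM {0..<n} M) (\<lambda>f. f)"
    by (rule distr_cong) (auto simp: space_C space_PiM PiE_restrict)
  also have "\<dots> = C 0 n (\<lambda>_. undefined)"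
    by (rule distr_id2) (simp add: sets_C)
  finally show ?thesis .
qed

lemma (in Ionescu_Tulcea) nn_integral_lim_restrict:
  assumes [measurable]: "f \<in> borel_measurable (PiM {0..<n} M)"
  shows "(\<integral>\<^sup>+\<omega>. f (restrict \<omega> {0..<n}) \<partial>PF.lim) = (\<integral>\<^sup>+\<omega>. f \<omega> \<partial>C 0 n (\<lambda>_. undefined))"
  unfolding CI_atLeastLessThan[symmetric]
  by (subst distr_lim[symmetric], simp, subst nn_integral_distr)
     (auto simp: measurable_cong_sets[OF PF.sets_lim refl] intro!: measurable_restrict)

text \<open>The tower property for the projective limit; in this form the kernels enter the later
  expectations.\<close>

lemma (in Ionescu_Tulcea) nn_integral_lim_step:
  assumes f[measurable]: "f \<in> borel_measurable (PiM {0..<Suc n} M)"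
  shows "(\<integral>\<^sup>+\<omega>. f (restrict \<omega> {0..<Suc n}) \<partial>PF.lim) =
    (\<integral>\<^sup>+\<omega>. (\<integral>\<^sup>+x. f ((restrict \<omega> {0..<n})(n := x)) \<partial>P n (restrict \<omega> {0..<n})) \<partial>PF.lim)"
proof -
  have m: "(\<lambda>h. \<integral>\<^sup>+x. f (h(n := x)) \<partial>P n h) \<in> borel_measurable (PiM {0..<n} M)"
  proof -
    have "(\<lambda>h. \<integral>\<^sup>+x. f x \<partial>eP n h) \<in> borel_measurable (PiM {0..<n} M)"
      by measurable
    then show ?thesis
      by (subst measurable_cong[where g="\<lambda>h. \<integral>\<^sup>+x. f x \<partial>eP n h"]) (auto simp: nn_integral_eP)
  qed
  have "(\<integral>\<^sup>+\<omega>. f (restrict \<omega> {0..<Suc n}) \<partial>PF.lim) = (\<integral>\<^sup>+\<omega>. f \<omega> \<partial>C 0 (Suc n) (\<lambda>_. undefined))"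
    by (rule nn_integral_lim_restrict) fact
  also have "\<dots> = (\<integral>\<^sup>+h. (\<integral>\<^sup>+x. f x \<partial>eP n h) \<partial>C 0 n (\<lambda>_. undefined))"
    by (simp, subst nn_integral_bind[where B="PiM {0..<Suc n} M"])
       (auto simp: measurable_cong_sets[OF sets_C refl])
  also have "\<dots> = (\<integral>\<^sup>+h. (\<integral>\<^sup>+x. f (h(n := x)) \<partial>P n h) \<partial>C 0 n (\<lambda>_. undefined))"
    by (intro nn_integral_cong nn_integral_eP f) (simp add: space_C)
  also have "\<dots> = (\<integral>\<^sup>+\<omega>. (\<integral>\<^sup>+x. f ((restrict \<omega> {0..<n})(n := x)) \<partial>P n (restrict \<omega> {0..<n})) \<partial>PF.lim)"
    by (rule nn_integral_lim_restrict[symmetric]) (rule m)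
  finally show ?thesis .
qed

lemma measurable_countable2:
  fixes \<phi> :: "'a::countable \<Rightarrow> 'b::countable \<Rightarrow> 'c"
  assumes [measurable]: "f \<in> M \<rightarrow>\<^sub>M count_space UNIV" "g \<in> M \<rightarrow>\<^sub>M count_space UNIV"
    and "\<And>a b. \<phi> a b \<in> space N"
  shows "(\<lambda>x. \<phi> (f x) (g x)) \<in> M \<rightarrow>\<^sub>M N"
proof -
  have "(\<lambda>x. (f x, g x)) \<in> M \<rightarrow>\<^sub>M count_space UNIV \<Otimes>\<^sub>M count_space UNIV"
    by measurable
  then have "(\<lambda>x. (f x, g x)) \<in> M \<rightarrow>\<^sub>M count_space UNIV"
    by (simp add: pair_measure_countable)
  from measurable_compose[OF this, of "case_prod \<phi>" N] assms(3) show ?thesis by auto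
qed

lemma snd_snd_record_measurable [measurable]:
  "(\<lambda>x. snd (snd x)) \<in> record_space \<rightarrow>\<^sub>M borel"
  unfolding record_space_def by measurable

definition jump_time :: "(nat \<Rightarrow> epoch_record) \<Rightarrow> nat \<Rightarrow> ennreal" where
  "jump_time \<omega> n = (\<Sum>k<n. snd (snd (\<omega> k)))"

text \<open>The rate-weighted sum over the two possible transitions. With \<open>\<phi>\<close>
  depending on source and target, one formula covers \<open>h\<close> at the target,
  \<open>h\<close> at the source, and the constant \<open>1\<close> that counts jumps. In state
  \<open>0\<close> the down rate vanishes, so the truncated \<open>s - 1\<close> is
  harmless.\<close>

definition jump_sum :: "nat \<Rightarrow> real \<Rightarrow> real \<Rightarrow> (nat \<Rightarrow> nat \<Rightarrow> ennreal) \<Rightarrow> nat \<Rightarrow> bool \<Rightarrow> ennreal" where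
  "jump_sum Smax lam nu \<phi> s a = ennreal (up_rate Smax lam s) * \<phi> s (s + 1) +
     ennreal (down_rate nu s a) * \<phi> s (s - 1)"

text \<open>Multiplying by the exit rate cancels the normalisation in \<open>jump_pmf\<close>; at
  rate zero both sides vanish, so the convention for the absorbing state has no effect.\<close>

lemma nn_integral_jump_pmf:
  assumes "lam > 0" "nu > 0"
  shows "ennreal (exit_rate Smax lam nu s a) * (\<integral>\<^sup>+y. \<phi> s y \<partial>jump_pmf Smax lam nu s a) =
    jump_sum Smax lam nu \<phi> s a"
proof -
  have u: "up_rate Smax lam s \<ge> 0" and d: "down_rate nu s a \<ge> 0"
    using assms by (auto simp: up_rate_def down_rate_def)
  show ?thesis
  proof (cases "exit_rate Smax lam nu s a = 0")
    case True
    then have "up_rate Smax lam s = 0" "down_rate nu s a = 0"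
      using u d by (auto simp: exit_rate_def)
    then show ?thesis by (simp add: exit_rate_def jump_sum_def)
  next
    case False
    define r where "r = exit_rate Smax lam nu s a"
    have r: "r > 0" and re: "r = up_rate Smax lam s + down_rate nu s a"
      using False u d by (auto simp: r_def exit_rate_def)
    have p: "up_rate Smax lam s / r \<in> {0..1}" using r u d by (auto simp: re field_simps)
    have e1: "r * (up_rate Smax lam s / r) = up_rate Smax lam s"
      and e2: "r * (1 - up_rate Smax lam s / r) = down_rate nu s a"
      using r by (auto simp: right_diff_distrib) (simp add: re)
    have "(\<integral>\<^sup>+y. \<phi> s y \<partial>jump_pmf Smax lam nu s a) =
      \<phi> s (s + 1) * ennreal (up_rate Smax lam s / r) + \<phi> s (s - 1) * ennreal (1 - up_rate Smax lam s / r)"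
      using False p by (simp add: jump_pmf_def r_def[symmetric])
    then have "ennreal r * (\<integral>\<^sup>+y. \<phi> s y \<partial>jump_pmf Smax lam nu s a) =
       (ennreal r * ennreal (up_rate Smax lam s / r)) * \<phi> s (s + 1)
       + (ennreal r * ennreal (1 - up_rate Smax lam s / r)) * \<phi> s (s - 1)"
      by (simp only: distrib_left mult_ac)
    also have "ennreal r * ennreal (up_rate Smax lam s / r) = ennreal (up_rate Smax lam s)"
      using r p by (subst ennreal_mult[symmetric]) (auto simp only: e1 less_imp_le atLeastAtMost_iff)
    also have "ennreal r * ennreal (1 - up_rate Smax lam s / r) = ennreal (down_rate nu s a)"
      using r p by (subst ennreal_mult[symmetric]) (auto simp only: e2 less_imp_le atLeastAtMost_iff diff_ge_0_iff_ge)
    finally show ?thesis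
      unfolding r_def[symmetric] jump_sum_def .
  qed
qed

section \<open>Conditional expectations under an admissible policy\<close>

locale admissible_process =
  fixes Smax :: nat and lam nu :: real and \<pi> :: policy and s0 :: nat
  assumes lam: "lam > 0" and nu: "nu > 0" and admissible: "admissible \<pi>" and s0: "s0 \<le> Smax"
begin

sublocale IT: Ionescu_Tulcea "kernel Smax lam nu \<pi> s0" "\<lambda>_. record_space"
  using lam nu admissible by (rule Ionescu_Tulcea_kernel)

abbreviation P :: "(nat \<Rightarrow> epoch_record) measure" where
  "P \<equiv> path_measure Smax lam nu \<pi> s0"

sublocale prob_space P
  using lam nu admissible by (rule prob_space_path_measure)

lemma P_eq: "P = IT.PF.lim"
  by (simp add: path_measure_def)

lemma sets_P [measurable_cong, simp]: "sets P = sets (PiM UNIV (\<lambda>_. record_space))"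
  by (simp add: P_eq)

lemma measurable_pred_component[measurable]:
  "(\<lambda>\<omega>. \<omega> k) \<in> PiM {0..<n} (\<lambda>_. record_space) \<rightarrow>\<^sub>M record_space" if "k < n" for k n :: nat
  using that by (intro measurable_component_singleton) auto

lemma measurable_jump_time:
  assumes "{..<n} \<subseteq> I"
  shows "(\<lambda>\<omega>. jump_time \<omega> n) \<in> borel_measurable (PiM I (\<lambda>_. record_space))"
proof -
  have "(\<lambda>\<omega>. snd (snd (\<omega> k))) \<in> borel_measurable (PiM I (\<lambda>_. record_space))" if "k < n" for k
    using that assms
    by (intro measurable_compose[OF measurable_component_singleton[of k I "\<lambda>_. record_space"] snd_snd_record_measurable]) auto
  then show ?thesis
    unfolding jump_time_def by (intro borel_measurable_sum) auto
qed

lemma measurable_component2: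
  fixes i j n :: nat
  assumes "i < n" "j < n" "\<And>a b. \<phi> a b \<in> space N"
  shows "(\<lambda>\<omega>. \<phi> (fst (\<omega> i)) (fst (\<omega> j))) \<in> PiM {0..<n} (\<lambda>_. record_space) \<rightarrow>\<^sub>M N"
proof -
  have "(\<lambda>\<omega>. fst (\<omega> k)) \<in> PiM {0..<n} (\<lambda>_. record_space) \<rightarrow>\<^sub>M count_space UNIV" if "k < n" for k
    using that by (rule measurable_compose[OF measurable_pred_component fst_record_measurable])
  from measurable_countable2[OF this[OF assms(1)] this[OF assms(2)], of \<phi> N] assms(3) show ?thesis
    by simp
qed

lemma nn_integral_kernel:
  assumes [measurable]: "G \<in> borel_measurable record_space"
  shows "(\<integral>\<^sup>+r. G r \<partial>kernel Smax lam nu \<pi> s0 n h) =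
    (\<integral>\<^sup>+s. (\<integral>\<^sup>+a. (\<integral>\<^sup>+\<tau>. G (s, a, \<tau>) \<partial>sojourn (exit_rate Smax lam nu s a))
      \<partial>bernoulli_pmf (\<pi> n h s)) \<partial>next_state Smax lam nu s0 n h)"
proof -
  let ?D = "\<lambda>s a. distr (sojourn (exit_rate Smax lam nu s a)) record_space (\<lambda>\<tau>. (s, a, \<tau>))"
  let ?B = "\<lambda>s. measure_pmf (bernoulli_pmf (\<pi> n h s)) \<bind> ?D s"
  have D: "?D s a \<in> space (prob_algebra record_space)" for s a
    using prob_space_record[OF lam nu] by (simp add: space_prob_algebra)
  have D': "?D s \<in> measure_pmf (bernoulli_pmf (\<pi> n h s)) \<rightarrow>\<^sub>M prob_algebra record_space" for s
    using D by simp
  have B: "?B s \<in> space (prob_algebra record_space)" for s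
  proof -
    have "(\<lambda>_. ?B s) \<in> count_space (UNIV :: unit set) \<rightarrow>\<^sub>M prob_algebra record_space"
      by (rule measurable_bind_prob_space[where N="count_space UNIV"])
         (use D in \<open>auto simp: space_prob_algebra measure_pmf.prob_space_axioms\<close>)
    from measurable_space[OF this, of "()"] show ?thesis by simp
  qed
  show ?thesis
    unfolding kernel_def
    apply (subst nn_integral_bind[where B=record_space])
      apply simp
     apply (rule measurable_prob_algebraD)
    using B apply simp
    apply (rule nn_integral_cong)
    apply (subst nn_integral_bind[where B=record_space])
      apply simp
     apply (rule measurable_prob_algebraD, rule D')
    apply (intro nn_integral_cong)
    apply (subst nn_integral_distr)
      apply auto
    done
qed

lemma nn_integral_kernel_state:
  "(\<integral>\<^sup>+r. G (fst r) \<partial>kernel Smax lam nu \<pi> s0 n h) = (\<integral>\<^sup>+s. G s \<partial>next_state Smax lam nu s0 n h)"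
proof -
  interpret S: prob_space "sojourn (exit_rate Smax lam nu s a)" for s a
    by (intro prob_space_sojourn exit_rate_nonneg lam nu)
  show ?thesis
    by (subst nn_integral_kernel)
       (auto simp: S.emeasure_space_1 measure_pmf.emeasure_space_1
         intro!: measurable_compose[OF fst_record_measurable])
qed

text \<open>Hypothesis \<open>f'\<close> says that \<open>f\<close> depends on the first
  \<open>n + 1\<close> records only, so it may be evaluated on full and on restricted paths
  alike.\<close>

lemma nn_integral_P_step:
  assumes f: "f \<in> borel_measurable (PiM {0..<Suc n} (\<lambda>_. record_space))"
    and f': "\<And>\<omega>. f (restrict \<omega> {0..<Suc n}) = f \<omega>"
  shows "(\<integral>\<^sup>+\<omega>. f \<omega> \<partial>P) =
    (\<integral>\<^sup>+\<omega>. (\<integral>\<^sup>+x. f ((restrict \<omega> {0..<n})(n := x)) \<partial>kernel Smax lam nu \<pi> s0 n (restrict \<omega> {0..<n})) \<partial>P)"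
  using IT.nn_integral_lim_step[OF f] by (simp only: f' P_eq)

lemma jump_time_restrict: "n \<le> m \<Longrightarrow> jump_time (restrict \<omega> {0..<m}) n = jump_time \<omega> n"
  unfolding jump_time_def by (intro sum.cong) auto

text \<open>Given the first \<open>n + 1\<close> records, the state entered next has law
  \<open>jump_pmf\<close>, whatever the policy. The factor \<open>g\<close> sees these records and
  may therefore involve the sojourn that precedes the jump.\<close>

lemma nn_integral_next_state:
  assumes g: "g \<in> borel_measurable (PiM {0..<Suc n} (\<lambda>_. record_space))"
    and g': "\<And>\<omega>. g (restrict \<omega> {0..<Suc n}) = g \<omega>"
  shows "(\<integral>\<^sup>+\<omega>. \<phi> (fst (\<omega> n)) (fst (\<omega> (Suc n))) * g \<omega> \<partial>P) =
    (\<integral>\<^sup>+\<omega>. (\<integral>\<^sup>+y. \<phi> (fst (\<omega> n)) y \<partial>jump_pmf Smax lam nu (fst (\<omega> n)) (fst (snd (\<omega> n)))) * g \<omega> \<partial>P)"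
proof -
  have cut: "restrict (restrict \<omega> {0..<Suc (Suc n)}) {0..<Suc n} = restrict \<omega> {0..<Suc n}"
    and upd: "restrict (fun_upd \<omega> (Suc n) x) {0..<Suc n} = restrict \<omega> {0..<Suc n}" for \<omega> :: "nat \<Rightarrow> epoch_record" and x
    by (auto simp: restrict_def)
  have g1: "g (restrict \<omega> {0..<Suc (Suc n)}) = g \<omega>" for \<omega>
    by (metis cut g')
  have g2: "g (fun_upd \<omega> (Suc n) x) = g \<omega>" for \<omega> x
    by (metis upd g')
  have gm: "g \<in> borel_measurable (PiM {0..<Suc (Suc n)} (\<lambda>_. record_space))"
  proof -
    have "(\<lambda>\<omega>. g (restrict \<omega> {0..<Suc n})) \<in> borel_measurable (PiM {0..<Suc (Suc n)} (\<lambda>_. record_space))"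
      by (rule measurable_compose[OF _ g]) (auto intro!: measurable_restrict_subset)
    then show ?thesis by (simp add: g')
  qed
  let ?f = "\<lambda>\<omega>. \<phi> (fst (\<omega> n)) (fst (\<omega> (Suc n))) * g \<omega>"
  have "?f \<in> borel_measurable (PiM {0..<Suc (Suc n)} (\<lambda>_. record_space))"
    by (intro borel_measurable_times_ennreal gm measurable_component2) auto
  moreover have "?f (restrict \<omega> {0..<Suc (Suc n)}) = ?f \<omega>" for \<omega>
    by (simp add: g1)
  moreover have "(\<integral>\<^sup>+x. ?f ((restrict \<omega> {0..<Suc n})(Suc n := x)) \<partial>kernel Smax lam nu \<pi> s0 (Suc n) (restrict \<omega> {0..<Suc n})) =
      (\<integral>\<^sup>+y. \<phi> (fst (\<omega> n)) y \<partial>jump_pmf Smax lam nu (fst (\<omega> n)) (fst (snd (\<omega> n)))) * g \<omega>" (is "?l = _") for \<omega>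
  proof -
    have "?l = (\<integral>\<^sup>+x. \<phi> (fst (\<omega> n)) (fst x) * g \<omega> \<partial>kernel Smax lam nu \<pi> s0 (Suc n) (restrict \<omega> {0..<Suc n}))"
      unfolding g2 g' fun_upd_same by simp
    also have "\<dots> = (\<integral>\<^sup>+y. \<phi> (fst (\<omega> n)) y * g \<omega> \<partial>jump_pmf Smax lam nu (fst (\<omega> n)) (fst (snd (\<omega> n))))"
      by (subst nn_integral_kernel_state[where G="\<lambda>y. \<phi> (fst (\<omega> n)) y * g \<omega>"])
         (simp add: next_state_def)
    finally show ?thesis by (simp add: nn_integral_multc)
  qed
  ultimately show ?thesis
    using nn_integral_P_step[of ?f "Suc n"] by simp
qed

text \<open>Once past, state and action are fixed, only the sojourn is random, and
  \<open>nn_integral_sojourn\<close> applies with \<open>jump_time h n\<close> as the elapsed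
  time.\<close>

lemma nn_integral_sojourn_step:
  assumes T: "T \<ge> 0"
  shows "(\<integral>\<^sup>+\<omega>. \<psi> (fst (\<omega> n)) (fst (snd (\<omega> n))) * indicator {..ennreal T} (jump_time \<omega> (Suc n)) \<partial>P) =
    (\<integral>\<^sup>+\<omega>. ennreal (exit_rate Smax lam nu (fst (\<omega> n)) (fst (snd (\<omega> n)))) * \<psi> (fst (\<omega> n)) (fst (snd (\<omega> n))) *
       (min (jump_time \<omega> (Suc n)) (ennreal T) - min (jump_time \<omega> n) (ennreal T)) \<partial>P)"
proof -
  have [measurable]: "(\<lambda>\<omega>. jump_time \<omega> n) \<in> borel_measurable (PiM {0..<Suc n} (\<lambda>_. record_space))"
     "(\<lambda>\<omega>. jump_time \<omega> (Suc n)) \<in> borel_measurable (PiM {0..<Suc n} (\<lambda>_. record_space))"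
    by (intro measurable_jump_time; auto)+
  have rm: "(\<lambda>x. \<psi> (fst x) (fst (snd x)) :: ennreal) \<in> borel_measurable record_space" for \<psi>
    by (rule measurable_countable2) auto
  have pm: "(\<lambda>\<omega>. \<psi> (fst (\<omega> n)) (fst (snd (\<omega> n))) :: ennreal) \<in> borel_measurable (PiM {0..<Suc n} (\<lambda>_. record_space))" for \<psi>
    by (intro measurable_compose[OF measurable_pred_component rm]) simp
  let ?I = "\<lambda>\<omega>. indicator {..ennreal T} (jump_time \<omega> (Suc n)) :: ennreal"
  let ?L = "\<lambda>\<omega>. min (jump_time \<omega> (Suc n)) (ennreal T) - min (jump_time \<omega> n) (ennreal T)"
  let ?r = "\<lambda>s a. ennreal (exit_rate Smax lam nu s a)"
  let ?f = "\<lambda>\<omega>. \<psi> (fst (\<omega> n)) (fst (snd (\<omega> n))) * ?I \<omega>"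
  let ?g = "\<lambda>\<omega>. (?r (fst (\<omega> n)) (fst (snd (\<omega> n))) * \<psi> (fst (\<omega> n)) (fst (snd (\<omega> n)))) * ?L \<omega>"
  have fm: "?f \<in> borel_measurable (PiM {0..<Suc n} (\<lambda>_. record_space))"
    by (intro borel_measurable_times_ennreal pm) measurable
  have gm: "?g \<in> borel_measurable (PiM {0..<Suc n} (\<lambda>_. record_space))"
    by (rule borel_measurable_times_ennreal, rule pm) measurable
  have step: "(\<integral>\<^sup>+x. ?f (h(n := x)) \<partial>kernel Smax lam nu \<pi> s0 n h) =
      (\<integral>\<^sup>+x. ?g (h(n := x)) \<partial>kernel Smax lam nu \<pi> s0 n h)" (is "?lhs = ?rhs") for h
  proof -
    have jt: "jump_time (fun_upd h n x) (Suc n) = jump_time h n + snd (snd x)"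
       "jump_time (fun_upd h n x) n = jump_time h n" for x
      by (auto simp: jump_time_def)
    let ?s = "\<lambda>s a. sojourn (exit_rate Smax lam nu s a)"
    have "?lhs = (\<integral>\<^sup>+x. \<psi> (fst x) (fst (snd x)) * indicator {..ennreal T} (jump_time h n + snd (snd x)) \<partial>kernel Smax lam nu \<pi> s0 n h)"
      by (simp add: jt)
    also have "\<dots> = (\<integral>\<^sup>+s. (\<integral>\<^sup>+a. (\<integral>\<^sup>+\<tau>. \<psi> s a * indicator {..ennreal T} (jump_time h n + \<tau>) \<partial>?s s a)
      \<partial>bernoulli_pmf (\<pi> n h s)) \<partial>next_state Smax lam nu s0 n h)"
      by (subst nn_integral_kernel) (auto intro!: borel_measurable_times_ennreal rm)
    also have "\<dots> = (\<integral>\<^sup>+s. (\<integral>\<^sup>+a. (\<integral>\<^sup>+\<tau>. (?r s a * \<psi> s a) *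
        (min (jump_time h n + \<tau>) (ennreal T) - min (jump_time h n) (ennreal T)) \<partial>?s s a)
      \<partial>bernoulli_pmf (\<pi> n h s)) \<partial>next_state Smax lam nu s0 n h)"
      by (rule nn_integral_cong, rule nn_integral_cong)
         (simp add: nn_integral_cmult nn_integral_sojourn[OF exit_rate_nonneg[OF lam nu] T] mult_ac)
    also have "\<dots> = (\<integral>\<^sup>+x. (?r (fst x) (fst (snd x)) * \<psi> (fst x) (fst (snd x))) *
       (min (jump_time h n + snd (snd x)) (ennreal T) - min (jump_time h n) (ennreal T)) \<partial>kernel Smax lam nu \<pi> s0 n h)"
      by (subst nn_integral_kernel) (auto intro!: borel_measurable_times_ennreal rm)
    also have "\<dots> = ?rhs"
      by (simp add: jt)
    finally show ?thesis .
  qed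
  have r: "?f (restrict \<omega> {0..<Suc n}) = ?f \<omega>" "?g (restrict \<omega> {0..<Suc n}) = ?g \<omega>" for \<omega>
    by (simp_all add: jump_time_restrict)
  show ?thesis
    by (rule trans[OF nn_integral_P_step[OF fm r(1)] trans[OF _ nn_integral_P_step[OF gm r(2), symmetric]]])
       (intro nn_integral_cong step)
qed

text \<open>The compensator of a single jump. The order follows the conditioning: the next state is
  averaged out given the sojourn, then the sojourn given state and action.\<close>

lemma nn_integral_jump:
  assumes T: "T \<ge> 0"
  shows "(\<integral>\<^sup>+\<omega>. \<phi> (fst (\<omega> n)) (fst (\<omega> (Suc n))) * indicator {..ennreal T} (jump_time \<omega> (Suc n)) \<partial>P) =
    (\<integral>\<^sup>+\<omega>. jump_sum Smax lam nu \<phi> (fst (\<omega> n)) (fst (snd (\<omega> n))) *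
       (min (jump_time \<omega> (Suc n)) (ennreal T) - min (jump_time \<omega> n) (ennreal T)) \<partial>P)"
proof -
  have m: "(\<lambda>\<omega>. indicator {..ennreal T} (jump_time \<omega> (Suc n)) :: ennreal) \<in>
      borel_measurable (PiM {0..<Suc n} (\<lambda>_. record_space))"
    by (rule measurable_compose[OF measurable_jump_time]) auto
  show ?thesis
    by (subst nn_integral_next_state[OF m], simp add: jump_time_restrict)
       (subst nn_integral_sojourn_step[OF T, where \<psi>="\<lambda>s a. \<integral>\<^sup>+y. \<phi> s y \<partial>jump_pmf Smax lam nu s a"],
        simp only: nn_integral_jump_pmf[OF lam nu])
qed

end

subsection \<open>Jump times and occupation integrals\<close>

lemma set_jump_pmf_le:
  assumes "lam > 0" "nu > 0" "s \<le> Smax" "y \<in> set_pmf (jump_pmf Smax lam nu s a)"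
  shows "y \<le> Smax"
proof (cases "s = Smax")
  case True
  then have "up_rate Smax lam s = 0" by (simp add: up_rate_def)
  then show ?thesis using assms True
    by (auto simp: jump_pmf_def set_pmf_iff[of _ "bernoulli_pmf 0"] split: if_splits)
next
  case False
  then show ?thesis using assms
    by (auto simp: jump_pmf_def split: if_splits)
qed

lemma exit_rate_le:
  assumes "lam > 0" "nu > 0" "s \<le> Smax"
  shows "exit_rate Smax lam nu s a \<le> lam + nu * real Smax"
  using assms mult_left_mono[of "real s" "real Smax" nu]
  by (auto simp: exit_rate_def up_rate_def down_rate_def intro!: add_mono mult_nonneg_nonneg split: if_splits)

lemma jump_sum_le:
  assumes "lam > 0" "nu > 0" "s \<le> Smax" "\<And>x y. \<phi> x y \<le> c"
  shows "jump_sum Smax lam nu \<phi> s a \<le> ennreal (lam + nu * real Smax) * c"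
proof -
  have "jump_sum Smax lam nu \<phi> s a \<le> ennreal (up_rate Smax lam s) * c + ennreal (down_rate nu s a) * c"
    unfolding jump_sum_def by (intro add_mono mult_left_mono assms) auto
  also have "\<dots> = ennreal (exit_rate Smax lam nu s a) * c"
    using assms by (simp add: exit_rate_def distrib_right up_rate_def down_rate_def)
  also have "\<dots> \<le> ennreal (lam + nu * real Smax) * c"
    by (intro mult_right_mono ennreal_leI exit_rate_le assms) auto
  finally show ?thesis .
qed

lemma jump_time_0 [simp]: "jump_time \<omega> 0 = 0"
  by (simp add: jump_time_def)

lemma jump_time_mono: "m \<le> n \<Longrightarrow> jump_time \<omega> m \<le> jump_time \<omega> n"
  unfolding jump_time_def by (intro sum_mono2) auto

text \<open>Telescopes: \<open>jump_time\<close> is monotone, so each difference in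
  \<open>ennreal\<close> restores its minuend when added back.\<close>

lemma sum_truncated_sojourns:
  "(\<Sum>k<n. min (jump_time \<omega> (Suc k)) c - min (jump_time \<omega> k) c) = min (jump_time \<omega> n) c"
proof (induction n)
  case (Suc n)
  have "min (jump_time \<omega> n) c \<le> min (jump_time \<omega> (Suc n)) c"
    by (intro min.mono jump_time_mono) auto
  then show ?case using Suc by (simp add: add_diff_inverse_ennreal)
qed simp

lemma suminf_truncated_sojourns_le:
  "(\<Sum>k. min (jump_time \<omega> (Suc k)) c - min (jump_time \<omega> k) c) \<le> c"
  by (intro suminf_le_const summableI) (simp add: sum_truncated_sojourns)

lemma suminf_single:
  fixes g :: "nat \<Rightarrow> 'a :: {comm_monoid_add, t2_space}"
  assumes "\<And>n. n \<noteq> N \<Longrightarrow> g n = 0"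
  shows "suminf g = g N"
  using assms by (subst suminf_finite[of "{N}"]) auto

text \<open>On these paths the \<open>LEAST\<close> in \<open>epoch\<close> exists at every time.\<close>

definition nonexplosive :: "(nat \<Rightarrow> epoch_record) \<Rightarrow> bool" where
  "nonexplosive \<omega> \<longleftrightarrow> (\<forall>m::nat. \<exists>n. of_nat m < jump_time \<omega> (Suc n))"

lemma nonexplosiveD: "nonexplosive \<omega> \<Longrightarrow> \<exists>n. ennreal t < jump_time \<omega> (Suc n)"
proof -
  assume a: "nonexplosive \<omega>"
  obtain m :: nat where "t \<le> real m" using real_arch_simple by blast
  then have "ennreal t \<le> of_nat m"
    by (metis ennreal_leI ennreal_of_nat_eq_real_of_nat)
  with a show ?thesis unfolding nonexplosive_def using le_less_trans by blast
qed

lemma epoch_eq_iff: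
  assumes "nonexplosive \<omega>"
  shows "epoch \<omega> t = n \<longleftrightarrow> jump_time \<omega> n \<le> ennreal t \<and> ennreal t < jump_time \<omega> (Suc n)"
proof -
  have e: "epoch \<omega> t = (LEAST n. ennreal t < jump_time \<omega> (Suc n))"
    by (simp add: epoch_def jump_time_def lessThan_Suc_atMost)
  have 1: "ennreal t < jump_time \<omega> (Suc (epoch \<omega> t))"
    unfolding e by (rule LeastI_ex) (rule nonexplosiveD[OF assms])
  have 2: "jump_time \<omega> (epoch \<omega> t) \<le> ennreal t"
  proof (cases "epoch \<omega> t")
    case (Suc m)
    then show ?thesis using not_less_Least[of m "\<lambda>n. ennreal t < jump_time \<omega> (Suc n)"]
      by (simp add: e)
  qed simp
  show ?thesis
  proof
    assume r: "jump_time \<omega> n \<le> ennreal t \<and> ennreal t < jump_time \<omega> (Suc n)"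
    have "\<not> Suc n \<le> epoch \<omega> t"
      using jump_time_mono[of "Suc n" "epoch \<omega> t" \<omega>] r 2 by auto
    moreover have "\<not> Suc (epoch \<omega> t) \<le> n"
      using jump_time_mono[of "Suc (epoch \<omega> t)" n \<omega>] r 1 by auto
    ultimately show "epoch \<omega> t = n" by simp
  qed (use 1 2 in auto)
qed

text \<open>Turns the event that a jump has occurred by \<open>t\<close> into a comparison of
  indices, which makes sums over jumps finite along a path.\<close>

lemma jump_time_le_iff:
  assumes "nonexplosive \<omega>"
  shows "jump_time \<omega> k \<le> ennreal t \<longleftrightarrow> k \<le> epoch \<omega> t"
proof -
  have "jump_time \<omega> (epoch \<omega> t) \<le> ennreal t" "ennreal t < jump_time \<omega> (Suc (epoch \<omega> t))"
    using epoch_eq_iff[OF assms] by blast+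
  then show ?thesis
    using jump_time_mono[of k "epoch \<omega> t" \<omega>] jump_time_mono[of "Suc (epoch \<omega> t)" k \<omega>]
    by (cases "k \<le> epoch \<omega> t") auto
qed

lemma measurable_epoch [measurable]:
  "(\<lambda>(\<omega>, t). epoch \<omega> t) \<in> PiM UNIV (\<lambda>_. record_space) \<Otimes>\<^sub>M borel \<rightarrow>\<^sub>M count_space UNIV"
proof -
  have [measurable]: "(\<lambda>\<omega>. \<omega> k) \<in> PiM UNIV (\<lambda>_. record_space) \<rightarrow>\<^sub>M record_space" for k :: nat
    by (rule measurable_component_singleton) simp
  have [measurable]: "(\<lambda>\<omega>. snd (snd (\<omega> k))) \<in> borel_measurable (PiM UNIV (\<lambda>_. record_space))" for k :: nat
    by (rule measurable_compose[OF _ snd_snd_record_measurable]) simp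
  have "(\<lambda>x. ennreal (snd x) < (\<Sum>k\<le>n. snd (snd (fst x k)))) \<in>
      PiM UNIV (\<lambda>_. record_space) \<Otimes>\<^sub>M borel \<rightarrow>\<^sub>M count_space UNIV" for n :: nat
    by measurable
  then show ?thesis
    unfolding epoch_def split_def by (rule measurable_Least)
qed

lemma measurable_at [measurable]:
  "(\<lambda>(\<omega>, t). F (state_at \<omega> t) (action_at \<omega> t) :: 'b :: topological_space) \<in>
    borel_measurable (PiM UNIV (\<lambda>_. record_space) \<Otimes>\<^sub>M borel)"
proof -
  have [measurable]: "(\<lambda>\<omega>. \<omega> k) \<in> PiM UNIV (\<lambda>_. record_space) \<rightarrow>\<^sub>M record_space" for k :: nat
    by (rule measurable_component_singleton) simp
  have e: "(\<lambda>x. epoch (fst x) (snd x)) \<in> PiM UNIV (\<lambda>_. record_space) \<Otimes>\<^sub>M borel \<rightarrow>\<^sub>M count_space UNIV"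
    using measurable_epoch by (simp add: split_def)
  have s: "(\<lambda>x. state_at (fst x) (snd x)) \<in> PiM UNIV (\<lambda>_. record_space) \<Otimes>\<^sub>M borel \<rightarrow>\<^sub>M count_space UNIV"
    unfolding state_at_def
    by (rule measurable_compose_countable[OF _ e, of "\<lambda>n x. fst (fst x n)"]) measurable
  have a: "(\<lambda>x. action_at (fst x) (snd x)) \<in> PiM UNIV (\<lambda>_. record_space) \<Otimes>\<^sub>M borel \<rightarrow>\<^sub>M count_space UNIV"
    unfolding action_at_def
    by (rule measurable_compose_countable[OF _ e, of "\<lambda>n x. fst (snd (fst x n))"]) measurable
  show ?thesis
    unfolding split_def by (rule measurable_countable2[OF s a]) simp
qed

lemma nn_integral_epoch_eq:
  assumes "nonexplosive \<omega>" "T \<ge> 0"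
  shows "(\<integral>\<^sup>+t. indicator {0..T} t * of_bool (epoch \<omega> t = n) \<partial>lborel) =
     min (jump_time \<omega> (Suc n)) (ennreal T) - min (jump_time \<omega> n) (ennreal T)"
proof -
  \<comment> \<open>Jump times may be infinite; truncated at \<open>T\<close> they can serve as real
    end points.\<close>
  define a b where "a = enn2real (min (jump_time \<omega> n) (ennreal T))"
    and "b = enn2real (min (jump_time \<omega> (Suc n)) (ennreal T))"
  have fin: "min x (ennreal T) < top" for x
    by (simp add: min_less_iff_disj)
  have a: "ennreal a = min (jump_time \<omega> n) (ennreal T)" "a \<ge> 0" and b: "ennreal b = min (jump_time \<omega> (Suc n)) (ennreal T)" "b \<ge> 0"
    unfolding a_def b_def using fin by auto
  have ab: "a \<le> b"
    unfolding a_def b_def by (intro enn2real_mono fin min.mono jump_time_mono) auto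
  have bT: "b \<le> T" using assms(2) b
    by (metis ennreal_le_iff min.cobounded2)
  \<comment> \<open>Sojourns are half-open while the horizon is closed, so the two indicators may
    differ at \<open>a\<close> and \<open>b\<close>, a null set.\<close>
  have pw: "indicator {0..T} t * of_bool (epoch \<omega> t = n) = (indicator {a..b} t :: ennreal)" if "t \<noteq> a" "t \<noteq> b" for t
  proof -
    have "t \<in> {0..T} \<and> epoch \<omega> t = n \<longleftrightarrow> t \<in> {a..b}"
    proof
      assume t: "t \<in> {0..T} \<and> epoch \<omega> t = n"
      then have j: "jump_time \<omega> n \<le> ennreal t" "ennreal t < jump_time \<omega> (Suc n)"
        using epoch_eq_iff[OF assms(1)] by auto
      have "ennreal a \<le> ennreal t" "ennreal t \<le> ennreal b"
        unfolding a b using t j by (auto simp: min_le_iff_disj intro: ennreal_leI less_imp_le)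
      then show "t \<in> {a..b}" using t b(2) by simp
    next
      assume t: "t \<in> {a..b}"
      with that have t: "a < t" "t < b" by auto
      then have l: "ennreal a < ennreal t" "ennreal t < ennreal b" using a(2) by (auto intro: ennreal_lessI)
      have "ennreal t \<le> ennreal T" using t bT by (auto intro: ennreal_leI)
      then have "jump_time \<omega> n \<le> ennreal t" "ennreal t < jump_time \<omega> (Suc n)"
        using l unfolding a b by (auto simp: min_less_iff_disj)
      then show "t \<in> {0..T} \<and> epoch \<omega> t = n"
        using t a bT by (auto simp: epoch_eq_iff[OF assms(1)])
    qed
    then show ?thesis by (auto simp: indicator_def)
  qed
  have "(\<integral>\<^sup>+t. indicator {0..T} t * of_bool (epoch \<omega> t = n) \<partial>lborel) = (\<integral>\<^sup>+t. indicator {a..b} t \<partial>lborel)"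
  proof (rule nn_integral_cong_AE)
    show "AE t in lborel. indicator {0..T} t * of_bool (epoch \<omega> t = n) = (indicator {a..b} t :: ennreal)"
      using AE_lborel_singleton[of a] AE_lborel_singleton[of b]
      by eventually_elim (rule pw)
  qed
  also have "\<dots> = ennreal b - ennreal a"
    using ab a(2) by (simp add: ennreal_minus)
  finally show ?thesis by (simp only: a b)
qed

text \<open>At each time only the term of the current epoch can be nonzero; exchanging sum and
  integral leaves the part of each sojourn within the horizon.\<close>

lemma nn_integral_occupation:
  fixes F :: "nat \<Rightarrow> bool \<Rightarrow> ennreal"
  assumes \<omega>: "nonexplosive \<omega>" "\<omega> \<in> space (PiM UNIV (\<lambda>_. record_space))" and T: "T \<ge> 0"
  shows "(\<integral>\<^sup>+t. indicator {0..T} t * F (state_at \<omega> t) (action_at \<omega> t) \<partial>lborel) =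
    (\<Sum>n. F (fst (\<omega> n)) (fst (snd (\<omega> n))) * (min (jump_time \<omega> (Suc n)) (ennreal T) - min (jump_time \<omega> n) (ennreal T)))"
proof -
  have m: "(\<lambda>t. epoch \<omega> t) \<in> borel \<rightarrow>\<^sub>M count_space UNIV"
    using measurable_Pair2[OF measurable_epoch \<omega>(2)] by simp
  have m2: "(\<lambda>t. indicator {0..T} t * of_bool (epoch \<omega> t = n) :: ennreal) \<in> borel_measurable lborel" for n
    by (intro borel_measurable_times_ennreal borel_measurable_indicator)
       (simp_all add: measurable_compose[OF m, of "\<lambda>k. of_bool (k = n)"])
  let ?c = "\<lambda>n. F (fst (\<omega> n)) (fst (snd (\<omega> n)))"
  have "indicator {0..T} t * F (state_at \<omega> t) (action_at \<omega> t) =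
      (\<Sum>n. ?c n * (indicator {0..T} t * of_bool (epoch \<omega> t = n)))" for t
  proof -
    have "(\<Sum>n. ?c n * (indicator {0..T} t * of_bool (epoch \<omega> t = n))) =
       ?c (epoch \<omega> t) * (indicator {0..T} t * of_bool (epoch \<omega> t = epoch \<omega> t))"
      by (rule suminf_single) simp
    then show ?thesis
      unfolding state_at_def action_at_def by (cases "t \<in> {0..T}") simp_all
  qed
  then have "(\<integral>\<^sup>+t. indicator {0..T} t * F (state_at \<omega> t) (action_at \<omega> t) \<partial>lborel) =
     (\<integral>\<^sup>+t. (\<Sum>n. ?c n * (indicator {0..T} t * of_bool (epoch \<omega> t = n))) \<partial>lborel)"
    by (rule nn_integral_cong)
  also have "\<dots> = (\<Sum>n. (\<integral>\<^sup>+t. ?c n * (indicator {0..T} t * of_bool (epoch \<omega> t = n)) \<partial>lborel))"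
    by (rule nn_integral_suminf) (intro borel_measurable_times_ennreal borel_measurable_const m2)
  also have "\<dots> = (\<Sum>n. ?c n * (min (jump_time \<omega> (Suc n)) (ennreal T) - min (jump_time \<omega> n) (ennreal T)))"
    unfolding nn_integral_cmult[OF m2] nn_integral_epoch_eq[OF \<omega>(1) T] ..
  finally show ?thesis .
qed

lemma AE_not_of_nn_integral_0:
  assumes "(\<lambda>x. of_bool (Q x) :: ennreal) \<in> borel_measurable M" "(\<integral>\<^sup>+x. of_bool (Q x) \<partial>M) = (0 :: ennreal)"
  shows "AE x in M. \<not> Q x"
proof -
  have "AE x in M. of_bool (Q x) = (0 :: ennreal)"
    using assms by (simp add: nn_integral_0_iff_AE)
  then show ?thesis by eventually_elim simp
qed

lemma measurable_count_space_of_bool: "(\<lambda>x. of_bool (Q x) :: ennreal) \<in> borel_measurable (count_space UNIV)"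
  by simp

section \<open>Almost sure properties of the paths\<close>

context admissible_process begin

lemma measurable_component_P [measurable]: "(\<lambda>\<omega>. \<omega> n) \<in> P \<rightarrow>\<^sub>M record_space"
  unfolding measurable_cong_sets[OF sets_P refl] by (rule measurable_component_singleton) simp

lemma measurable_jump_time_P [measurable]: "(\<lambda>\<omega>. jump_time \<omega> n) \<in> borel_measurable P"
  unfolding measurable_cong_sets[OF sets_P refl] by (rule measurable_jump_time) simp

lemma measurable_state [measurable]: "(\<lambda>\<omega>. fst (\<omega> n)) \<in> P \<rightarrow>\<^sub>M count_space UNIV"
  by (rule measurable_compose[OF measurable_component_P fst_record_measurable])

lemma measurable_action [measurable]: "(\<lambda>\<omega>. fst (snd (\<omega> n))) \<in> P \<rightarrow>\<^sub>M count_space UNIV"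
  by (rule measurable_compose[OF measurable_component_P fst_snd_record_measurable])

lemma space_P: "space P = space (PiM UNIV (\<lambda>_. record_space))"
  by (rule sets_eq_imp_space_eq) simp

lemma measurable_state_action [measurable]:
  "(\<lambda>\<omega>. \<psi> (fst (\<omega> n)) (fst (snd (\<omega> n))) :: ennreal) \<in> borel_measurable P"
  by (rule measurable_countable2[OF measurable_state measurable_action]) simp

lemma AE_initial: "AE \<omega> in P. fst (\<omega> 0) = s0"
proof -
  let ?f = "\<lambda>\<omega>. of_bool (fst (\<omega> 0) \<noteq> s0) :: ennreal"
  have "?f \<in> borel_measurable (PiM {0..<Suc 0} (\<lambda>_. record_space))"
    by (rule measurable_component2[of 0 "Suc 0" 0 "\<lambda>a _. of_bool (a \<noteq> s0)"]) auto
  then have "(\<integral>\<^sup>+\<omega>. ?f \<omega> \<partial>P) = (\<integral>\<^sup>+\<omega>. (\<integral>\<^sup>+x. of_bool (fst x \<noteq> s0)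
      \<partial>kernel Smax lam nu \<pi> s0 0 (restrict \<omega> {0..<0})) \<partial>P)"
    using nn_integral_P_step[of ?f 0] by simp
  also have "\<dots> = 0"
    by (subst nn_integral_kernel_state) (simp add: next_state_def)
  finally have "AE \<omega> in P. \<not> fst (\<omega> 0) \<noteq> s0"
    by (rule AE_not_of_nn_integral_0[OF measurable_compose[OF measurable_state measurable_count_space_of_bool]])
  then show ?thesis by eventually_elim simp
qed

text \<open>Induction over the epochs: \<open>nn_integral_next_state\<close> is applied to the
  indicator of leaving the state space, with \<open>g\<close> constantly \<open>1\<close>.\<close>

lemma AE_state_le: "AE \<omega> in P. \<forall>n. fst (\<omega> n) \<le> Smax"
proof (subst AE_all_countable, rule allI)
  fix n show "AE \<omega> in P. fst (\<omega> n) \<le> Smax"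
  proof (induction n)
    case 0
    from AE_initial show ?case by eventually_elim (simp add: s0)
  next
    case (Suc n)
    let ?\<phi> = "\<lambda>x y. of_bool (y > Smax) :: ennreal"
    have "(\<integral>\<^sup>+\<omega>. ?\<phi> (fst (\<omega> n)) (fst (\<omega> (Suc n))) * 1 \<partial>P) =
      (\<integral>\<^sup>+\<omega>. (\<integral>\<^sup>+y. ?\<phi> (fst (\<omega> n)) y \<partial>jump_pmf Smax lam nu (fst (\<omega> n)) (fst (snd (\<omega> n)))) * 1 \<partial>P)"
      by (rule nn_integral_next_state[where \<phi>="?\<phi>"]) simp_all
    also have "\<dots> = (\<integral>\<^sup>+\<omega>. 0 \<partial>P)"
    proof (rule nn_integral_cong_AE)
      have "(\<integral>\<^sup>+y. ?\<phi> s y \<partial>jump_pmf Smax lam nu s a) = 0" if "s \<le> Smax" for s a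
        by (subst nn_integral_0_iff_AE)
           (use set_jump_pmf_le[OF lam nu that] in \<open>auto simp: AE_measure_pmf_iff not_less\<close>)
      with Suc show "AE \<omega> in P. (\<integral>\<^sup>+y. ?\<phi> (fst (\<omega> n)) y \<partial>jump_pmf Smax lam nu (fst (\<omega> n)) (fst (snd (\<omega> n)))) * 1 = 0"
        by (auto elim!: eventually_mono)
    qed
    \<comment> \<open>\<open>?\<phi>\<close> ignores its first argument; \<open>0\<close> is a
      dummy.\<close>
    finally have "(\<integral>\<^sup>+\<omega>. ?\<phi> 0 (fst (\<omega> (Suc n))) \<partial>P) = 0"
      by simp
    then have "AE \<omega> in P. \<not> fst (\<omega> (Suc n)) > Smax"
      by (rule AE_not_of_nn_integral_0[OF measurable_compose[OF measurable_state measurable_count_space_of_bool]])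
    then show ?case by eventually_elim (simp add: not_less)
  qed
qed

lemma AE_action:
  assumes "\<pi> = stationary f"
  shows "AE \<omega> in P. \<forall>n. fst (snd (\<omega> n)) = f (fst (\<omega> n))"
proof (subst AE_all_countable, rule allI)
  fix n
  let ?q = "\<lambda>x. of_bool (fst (snd x) \<noteq> f (fst x)) :: ennreal"
  interpret S: prob_space "sojourn (exit_rate Smax lam nu s a)" for s a
    by (intro prob_space_sojourn exit_rate_nonneg lam nu)
  have q: "?q \<in> borel_measurable record_space"
    by (rule measurable_countable2[of fst record_space "\<lambda>x. fst (snd x)" "\<lambda>s a. of_bool (a \<noteq> f s)"]) simp_all
  have "(\<lambda>\<omega>. ?q (\<omega> n)) \<in> borel_measurable (PiM {0..<Suc n} (\<lambda>_. record_space))"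
    by (rule measurable_compose[OF measurable_pred_component q]) simp
  then have "(\<integral>\<^sup>+\<omega>. ?q (\<omega> n) \<partial>P) =
      (\<integral>\<^sup>+\<omega>. (\<integral>\<^sup>+x. ?q x \<partial>kernel Smax lam nu \<pi> s0 n (restrict \<omega> {0..<n})) \<partial>P)"
    by (subst nn_integral_P_step[of "\<lambda>\<omega>. ?q (\<omega> n)" n]) simp_all
  also have "\<dots> = 0"
  proof -
    have "(\<integral>\<^sup>+a. (\<integral>\<^sup>+\<tau>. ?q (s, a, \<tau>) \<partial>sojourn (exit_rate Smax lam nu s a)) \<partial>bernoulli_pmf (\<pi> n h s)) = 0" for h s
      by (cases "f s"; simp add: assms stationary_def)
    then show ?thesis by (simp only: nn_integral_kernel[OF q] nn_integral_const mult_zero_left)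
  qed
  finally have "AE \<omega> in P. \<not> fst (snd (\<omega> n)) \<noteq> f (fst (\<omega> n))"
    by (rule AE_not_of_nn_integral_0[OF measurable_compose[OF measurable_component_P q]])
  then show "AE \<omega> in P. fst (snd (\<omega> n)) = f (fst (\<omega> n))" by eventually_elim simp
qed

text \<open>Sums the compensators: on the state space the rates are at most
  \<open>lam + nu * real Smax\<close>, and the truncated sojourns add up to at most
  \<open>T\<close>. With \<open>\<phi>\<close> constantly \<open>1\<close> this bounds the expected
  number of jumps.\<close>

lemma suminf_nn_integral_jump_le:
  assumes T: "T \<ge> 0" and \<phi>: "\<And>x y. \<phi> x y \<le> c"
  shows "(\<Sum>n. \<integral>\<^sup>+\<omega>. \<phi> (fst (\<omega> n)) (fst (\<omega> (Suc n))) * indicator {..ennreal T} (jump_time \<omega> (Suc n)) \<partial>P)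
    \<le> ennreal (lam + nu * real Smax) * c * ennreal T"
proof -
  let ?L = "\<lambda>\<omega> n. min (jump_time \<omega> (Suc n)) (ennreal T) - min (jump_time \<omega> n) (ennreal T)"
  let ?C = "ennreal (lam + nu * real Smax) * c"
  have "(\<Sum>n. \<integral>\<^sup>+\<omega>. \<phi> (fst (\<omega> n)) (fst (\<omega> (Suc n))) * indicator {..ennreal T} (jump_time \<omega> (Suc n)) \<partial>P)
     = (\<Sum>n. \<integral>\<^sup>+\<omega>. jump_sum Smax lam nu \<phi> (fst (\<omega> n)) (fst (snd (\<omega> n))) * ?L \<omega> n \<partial>P)"
    by (simp only: nn_integral_jump[OF T])
  also have "\<dots> = (\<integral>\<^sup>+\<omega>. (\<Sum>n. jump_sum Smax lam nu \<phi> (fst (\<omega> n)) (fst (snd (\<omega> n))) * ?L \<omega> n) \<partial>P)"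
    by (subst nn_integral_suminf) (rule borel_measurable_times_ennreal, rule measurable_state_action, measurable)
  also have "\<dots> \<le> (\<integral>\<^sup>+\<omega>. ?C * ennreal T \<partial>P)"
  proof (rule nn_integral_mono_AE)
    from AE_state_le show "AE \<omega> in P. (\<Sum>n. jump_sum Smax lam nu \<phi> (fst (\<omega> n)) (fst (snd (\<omega> n))) * ?L \<omega> n) \<le> ?C * ennreal T"
    proof eventually_elim
      case (elim \<omega>)
      have "(\<Sum>n. jump_sum Smax lam nu \<phi> (fst (\<omega> n)) (fst (snd (\<omega> n))) * ?L \<omega> n) \<le> (\<Sum>n. ?C * ?L \<omega> n)"
        using elim by (intro suminf_le mult_right_mono jump_sum_le lam nu \<phi> summableI) auto
      also have "\<dots> = ?C * (\<Sum>n. ?L \<omega> n)" by (rule ennreal_suminf_cmult)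
      also have "\<dots> \<le> ?C * ennreal T" by (intro mult_left_mono suminf_truncated_sojourns_le) simp
      finally show ?case .
    qed
  qed
  also have "\<dots> = ?C * ennreal T" by (simp add: emeasure_space_1)
  finally show ?thesis .
qed

text \<open>A finite expected number of jumps up to \<open>m\<close> makes the number finite almost
  surely. Integer horizons suffice, so only countably many null sets are involved.\<close>

lemma AE_nonexplosive: "AE \<omega> in P. nonexplosive \<omega>"
  unfolding nonexplosive_def
proof (subst AE_all_countable, rule allI)
  fix m :: nat
  let ?I = "\<lambda>\<omega> n. indicator {..ennreal (real m)} (jump_time \<omega> (Suc n)) :: ennreal"
  have m: "(\<lambda>\<omega>. ?I \<omega> n) \<in> borel_measurable P" for n
    by measurable
  have "(\<integral>\<^sup>+\<omega>. (\<Sum>n. ?I \<omega> n) \<partial>P) = (\<Sum>n. \<integral>\<^sup>+\<omega>. 1 * ?I \<omega> n \<partial>P)"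
    by (simp add: nn_integral_suminf[OF m])
  also have "\<dots> \<le> ennreal (lam + nu * real Smax) * 1 * ennreal (real m)"
    by (rule suminf_nn_integral_jump_le[where \<phi>="\<lambda>_ _. 1"]) simp_all
  also have "\<dots> < top" by (simp add: ennreal_mult_less_top)
  finally have "AE \<omega> in P. (\<Sum>n. ?I \<omega> n) \<noteq> \<infinity>"
    by (intro nn_integral_PInf_AE borel_measurable_suminf m) auto
  then show "AE \<omega> in P. \<exists>n. of_nat m < jump_time \<omega> (Suc n)"
  proof eventually_elim
    case (elim \<omega>)
    show ?case
    proof (rule ccontr)
      assume "\<nexists>n. of_nat m < jump_time \<omega> (Suc n)"
      then have "?I \<omega> n = 1" for n
        by (auto simp: indicator_def not_less ennreal_of_nat_eq_real_of_nat)
      then have "(\<Sum>n. ?I \<omega> n) = (\<Sum>n. 1 :: ennreal)" by simp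
      also have "\<dots> = top"
        by (simp add: nn_integral_count_space_nat[symmetric])
      finally show False using elim by simp
    qed
  qed
qed

section \<open>From sums over jumps to time integrals\<close>

lemma nn_integral_at_jump_sum:
  assumes T: "T \<ge> 0"
  shows "(\<integral>\<^sup>+\<omega>. (\<integral>\<^sup>+t. indicator {0..T} t * jump_sum Smax lam nu \<phi> (state_at \<omega> t) (action_at \<omega> t) \<partial>lborel) \<partial>P) =
    (\<Sum>n. \<integral>\<^sup>+\<omega>. \<phi> (fst (\<omega> n)) (fst (\<omega> (Suc n))) * indicator {..ennreal T} (jump_time \<omega> (Suc n)) \<partial>P)"
proof -
  let ?L = "\<lambda>\<omega> n. min (jump_time \<omega> (Suc n)) (ennreal T) - min (jump_time \<omega> n) (ennreal T)"
  have "(\<integral>\<^sup>+\<omega>. (\<integral>\<^sup>+t. indicator {0..T} t * jump_sum Smax lam nu \<phi> (state_at \<omega> t) (action_at \<omega> t) \<partial>lborel) \<partial>P) =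
     (\<integral>\<^sup>+\<omega>. (\<Sum>n. jump_sum Smax lam nu \<phi> (fst (\<omega> n)) (fst (snd (\<omega> n))) * ?L \<omega> n) \<partial>P)"
  proof (rule nn_integral_cong_AE)
    show "AE \<omega> in P. (\<integral>\<^sup>+t. indicator {0..T} t * jump_sum Smax lam nu \<phi> (state_at \<omega> t) (action_at \<omega> t) \<partial>lborel) =
       (\<Sum>n. jump_sum Smax lam nu \<phi> (fst (\<omega> n)) (fst (snd (\<omega> n))) * ?L \<omega> n)"
      using AE_nonexplosive AE_space
    proof eventually_elim
      case (elim \<omega>)
      then show ?case using T by (intro nn_integral_occupation) (simp_all add: space_P)
    qed
  qed
  also have "\<dots> = (\<Sum>n. \<integral>\<^sup>+\<omega>. jump_sum Smax lam nu \<phi> (fst (\<omega> n)) (fst (snd (\<omega> n))) * ?L \<omega> n \<partial>P)"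
    by (subst nn_integral_suminf) (rule borel_measurable_times_ennreal, rule measurable_state_action, measurable)
  finally show ?thesis by (simp only: nn_integral_jump[OF T])
qed

text \<open>Negative terms are moved to the other side because subtraction in \<open>ennreal\<close>
  is truncated. The two choices of \<open>\<phi>\<close> are the parts of the generator:
  \<open>h\<close> at the target of a jump and \<open>h\<close> at its source. Along a path they
  telescope.\<close>

lemma nn_dynkin:
  fixes h :: "nat \<Rightarrow> ennreal"
  assumes T: "T \<ge> 0"
  shows "(\<integral>\<^sup>+\<omega>. (\<integral>\<^sup>+t. indicator {0..T} t * jump_sum Smax lam nu (\<lambda>_. h) (state_at \<omega> t) (action_at \<omega> t) \<partial>lborel) \<partial>P) + h s0 =
    (\<integral>\<^sup>+\<omega>. (\<integral>\<^sup>+t. indicator {0..T} t * jump_sum Smax lam nu (\<lambda>x _. h x) (state_at \<omega> t) (action_at \<omega> t) \<partial>lborel) \<partial>P) +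
    (\<integral>\<^sup>+\<omega>. h (state_at \<omega> T) \<partial>P)"
proof -
  let ?I = "\<lambda>\<omega> n. indicator {..ennreal T} (jump_time \<omega> (Suc n)) :: ennreal"
  have m: "(\<lambda>\<omega>. h (fst (\<omega> k)) * ?I \<omega> n) \<in> borel_measurable P" for k n
    by (intro borel_measurable_times_ennreal measurable_compose[OF measurable_state]) auto
  have mT: "(\<lambda>\<omega>. h (state_at \<omega> T)) \<in> borel_measurable P"
  proof -
    have "(\<lambda>\<omega>. (\<omega>, T)) \<in> P \<rightarrow>\<^sub>M PiM UNIV (\<lambda>_. record_space) \<Otimes>\<^sub>M borel" by measurable
    from measurable_compose[OF this measurable_at[of "\<lambda>s _. h s"]] show ?thesis by simp
  qed
  have "(\<Sum>n. \<integral>\<^sup>+\<omega>. h (fst (\<omega> (Suc n))) * ?I \<omega> n \<partial>P) + h s0 =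
      (\<integral>\<^sup>+\<omega>. (\<Sum>n. h (fst (\<omega> (Suc n))) * ?I \<omega> n) \<partial>P) + (\<integral>\<^sup>+\<omega>. h s0 \<partial>P)"
    by (simp add: nn_integral_suminf[OF m] emeasure_space_1)
  also have "\<dots> = (\<integral>\<^sup>+\<omega>. (\<Sum>n. h (fst (\<omega> (Suc n))) * ?I \<omega> n) + h s0 \<partial>P)"
    by (rule nn_integral_add[symmetric]) (auto intro!: borel_measurable_suminf m)
  also have "\<dots> = (\<integral>\<^sup>+\<omega>. (\<Sum>n. h (fst (\<omega> n)) * ?I \<omega> n) + h (state_at \<omega> T) \<partial>P)"
  proof (rule nn_integral_cong_AE)
    show "AE \<omega> in P. (\<Sum>n. h (fst (\<omega> (Suc n))) * ?I \<omega> n) + h s0 = (\<Sum>n. h (fst (\<omega> n)) * ?I \<omega> n) + h (state_at \<omega> T)"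
      using AE_nonexplosive AE_initial
    proof eventually_elim
      case (elim \<omega>)
      let ?N = "epoch \<omega> T"
      \<comment> \<open>By non-explosion exactly the jumps with index below the current epoch count,
        so both series are finite sums that differ only in their end terms.\<close>
      have I: "?I \<omega> n = of_bool (n < ?N)" for n
        by (auto simp: indicator_def jump_time_le_iff[OF elim(1)])
      have s: "(\<Sum>n. g n * ?I \<omega> n) = (\<Sum>n<?N. g n)" for g :: "nat \<Rightarrow> ennreal"
      proof -
        have "(\<Sum>n. g n * ?I \<omega> n) = (\<Sum>n<?N. g n * ?I \<omega> n)"
          by (rule suminf_finite) (simp_all add: I)
        also have "\<dots> = (\<Sum>n<?N. g n)" by (rule sum.cong) (simp_all add: I)
        finally show ?thesis .
      qed
      have "h (fst (\<omega> 0)) + (\<Sum>n<?N. h (fst (\<omega> (Suc n)))) = (\<Sum>n<?N. h (fst (\<omega> n))) + h (fst (\<omega> ?N))"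
        using sum.lessThan_Suc_shift[of "\<lambda>n. h (fst (\<omega> n))" ?N] by simp
      then show ?case
        unfolding s by (simp add: elim(2) state_at_def add.commute)
    qed
  qed
  also have "\<dots> = (\<integral>\<^sup>+\<omega>. (\<Sum>n. h (fst (\<omega> n)) * ?I \<omega> n) \<partial>P) + (\<integral>\<^sup>+\<omega>. h (state_at \<omega> T) \<partial>P)"
    by (rule nn_integral_add) (auto intro!: borel_measurable_suminf m mT)
  also have "(\<integral>\<^sup>+\<omega>. (\<Sum>n. h (fst (\<omega> n)) * ?I \<omega> n) \<partial>P) = (\<Sum>n. \<integral>\<^sup>+\<omega>. h (fst (\<omega> n)) * ?I \<omega> n \<partial>P)"
    by (rule nn_integral_suminf[OF m])
  finally show ?thesis
    using nn_integral_at_jump_sum[OF T, of "\<lambda>_. h"] nn_integral_at_jump_sum[OF T, of "\<lambda>x _. h x"] by simp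
qed

end

subsection \<open>Dynkin's formula and verification\<close>

lemma ex_bound_atMost: "\<exists>B. \<forall>s\<le>n. \<bar>h s :: real\<bar> \<le> B" for n :: nat
proof -
  have "\<bar>h s\<bar> \<le> Max ((\<lambda>s. \<bar>h s\<bar>) ` {..n})" if "s \<le> n" for s
    using that by (intro Max_ge) auto
  then show ?thesis by blast
qed

lemma tendsto_perturbed: "((\<lambda>T::real. ereal (g + c / T)) \<longlongrightarrow> ereal g) at_top"
proof -
  have "((\<lambda>T::real. g + c / T) \<longlongrightarrow> g + 0) at_top"
    by (intro tendsto_add tendsto_const tendsto_divide_0[OF tendsto_const] filterlim_at_top_imp_at_infinity filterlim_ident)
  then show ?thesis by simp
qed

definition generator :: "nat \<Rightarrow> real \<Rightarrow> real \<Rightarrow> (nat \<Rightarrow> real) \<Rightarrow> nat \<Rightarrow> bool \<Rightarrow> real" where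
  "generator Smax lam nu h s a =
     up_rate Smax lam s * (h (s + 1) - h s) + down_rate nu s a * (h (s - 1) - h s)"

lemma generator_diff:
  "generator Smax lam nu (\<lambda>s. p s - q s) s a = generator Smax lam nu p s a - generator Smax lam nu q s a"
  by (simp add: generator_def algebra_simps)

definition running_cost :: "real \<Rightarrow> nat \<Rightarrow> bool \<Rightarrow> real" where
  "running_cost W s a = real s - W * (1 - of_bool a)"

section \<open>Expected time integrals as real numbers\<close>

context admissible_process begin

text \<open>The iterated integral has the shape used in \<open>average_cost\<close>;
  \<open>integral_integrand\<close> moves it to the product measure, where linearity and
  monotonicity rest on a single integrability fact.\<close>

definition expected_integral :: "real \<Rightarrow> (nat \<Rightarrow> bool \<Rightarrow> real) \<Rightarrow> real" where
  "expected_integral T F = (\<integral>\<omega>. (LBINT t:{0..T}. F (state_at \<omega> t) (action_at \<omega> t)) \<partial>P)"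

abbreviation time_path :: "((nat \<Rightarrow> epoch_record) \<times> real) measure" where
  "time_path \<equiv> P \<Otimes>\<^sub>M lborel"

abbreviation (input) integrand :: "real \<Rightarrow> (nat \<Rightarrow> bool \<Rightarrow> real) \<Rightarrow> (nat \<Rightarrow> epoch_record) \<times> real \<Rightarrow> real" where
  "integrand T F \<equiv> \<lambda>x. indicator {0..T} (snd x) * F (state_at (fst x) (snd x)) (action_at (fst x) (snd x))"

sublocale PL: pair_sigma_finite P lborel ..

lemma measurable_at_time_path:
  "(\<lambda>x. F (state_at (fst x) (snd x)) (action_at (fst x) (snd x)) :: 'b :: topological_space) \<in> borel_measurable time_path"
proof -
  have "sets time_path = sets (PiM UNIV (\<lambda>_. record_space) \<Otimes>\<^sub>M borel)"
    by (intro sets_pair_measure_cong) simp_all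
  from measurable_cong_sets[OF this refl] show ?thesis
    using measurable_at[of F] by (simp add: split_def)
qed

lemma measurable_at_time:
  "(\<lambda>\<omega>. F (state_at \<omega> T) (action_at \<omega> T) :: 'b :: topological_space) \<in> borel_measurable P"
proof -
  have "(\<lambda>\<omega>. (\<omega>, T)) \<in> P \<rightarrow>\<^sub>M time_path" by measurable
  from measurable_compose[OF this measurable_at_time_path[of F]] show ?thesis by simp
qed

lemma measurable_integrand: "integrand T F \<in> borel_measurable time_path"
  by (intro borel_measurable_times measurable_at_time_path) measurable

text \<open>\<open>state_at\<close> and \<open>action_at\<close> read the same record, so what holds
  for all records of a path holds at all times.\<close>

lemma AE_time_path:
  assumes "AE \<omega> in P. \<forall>n. Q (fst (\<omega> n)) (fst (snd (\<omega> n)))"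
  shows "AE x in time_path. Q (state_at (fst x) (snd x)) (action_at (fst x) (snd x))"
proof -
  have "{x \<in> space time_path. Q (state_at (fst x) (snd x)) (action_at (fst x) (snd x))} =
     (\<lambda>x. of_bool (Q (state_at (fst x) (snd x)) (action_at (fst x) (snd x))) :: real) -` {1} \<inter> space time_path"
    by auto
  also have "\<dots> \<in> sets time_path"
    by (rule measurable_sets[OF measurable_at_time_path[of "\<lambda>s a. of_bool (Q s a)"]]) simp
  finally have "{x \<in> space time_path. Q (state_at (fst x) (snd x)) (action_at (fst x) (snd x))} \<in> sets time_path" .
  then show ?thesis
    by (rule PL.AE_pair_measure) (use assms in eventually_elim, simp add: state_at_def action_at_def)
qed

lemma AE_time_path_le: "AE x in time_path. state_at (fst x) (snd x) \<le> Smax"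
  using AE_state_le by (rule AE_time_path)

lemma integrable_integrand: "integrable time_path (integrand T F)"
proof -
  \<comment> \<open>Two actions and finitely many states: one bound covers all values of
    \<open>F\<close> that occur almost surely.\<close>
  obtain B where B: "\<And>s. s \<le> Smax \<Longrightarrow> \<bar>\<bar>F s True\<bar> + \<bar>F s False\<bar>\<bar> \<le> B"
    using ex_bound_atMost[of Smax "\<lambda>s. \<bar>F s True\<bar> + \<bar>F s False\<bar>"] by blast
  have B: "\<bar>F s a\<bar> \<le> B" if "s \<le> Smax" for s a
    using B[OF that] by (cases a) auto
  have nn: "(\<integral>\<^sup>+x. ennreal (norm (integrand T F x)) \<partial>time_path) \<le> (\<integral>\<^sup>+x. ennreal B * indicator {0..T} (snd x) \<partial>time_path)"
    by (rule nn_integral_mono_AE)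
       (use AE_time_path_le in eventually_elim, auto simp: indicator_def intro!: ennreal_leI B)
  also have "\<dots> = (\<integral>\<^sup>+\<omega>. (\<integral>\<^sup>+t. ennreal B * indicator {0..T} t \<partial>lborel) \<partial>P)"
    by (subst lborel.nn_integral_fst[symmetric]) simp_all
  also have "\<dots> = ennreal B * emeasure lborel {0..T}"
    by (simp add: nn_integral_cmult emeasure_space_1)
  also have "\<dots> < \<infinity>"
    by (simp add: ennreal_mult_less_top emeasure_lborel_Icc_eq)
  finally show ?thesis
    by (intro integrableI_bounded measurable_integrand)
qed

lemma integral_integrand: "expected_integral T F = (\<integral>x. integrand T F x \<partial>time_path)"
  unfolding expected_integral_def set_lebesgue_integral_def
  using PL.integral_fst'[OF integrable_integrand[of T F]] by simp

lemma expected_integral_add: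
  "expected_integral T (\<lambda>s a. F s a + G s a) = expected_integral T F + expected_integral T G"
  unfolding integral_integrand
  by (subst Bochner_Integration.integral_add[OF integrable_integrand integrable_integrand, symmetric])
     (simp add: distrib_left)

lemma expected_integral_diff:
  "expected_integral T (\<lambda>s a. F s a - G s a) = expected_integral T F - expected_integral T G"
  unfolding integral_integrand
  by (subst Bochner_Integration.integral_diff[OF integrable_integrand integrable_integrand, symmetric])
     (simp add: right_diff_distrib)

lemma expected_integral_const: "T \<ge> 0 \<Longrightarrow> expected_integral T (\<lambda>_ _. c) = c * T"
  unfolding expected_integral_def set_lebesgue_integral_def by (simp add: prob_space)

lemma expected_integral_mono:
  assumes "AE x in time_path. F (state_at (fst x) (snd x)) (action_at (fst x) (snd x))
     \<le> G (state_at (fst x) (snd x)) (action_at (fst x) (snd x))"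
  shows "expected_integral T F \<le> expected_integral T G"
  unfolding integral_integrand
  by (intro integral_mono_AE integrable_integrand)
     (use assms in eventually_elim, simp add: indicator_def)

lemma nn_integral_expected_integral:
  assumes "\<And>s a. F s a \<ge> 0"
  shows "(\<integral>\<^sup>+\<omega>. (\<integral>\<^sup>+t. indicator {0..T} t * ennreal (F (state_at \<omega> t) (action_at \<omega> t)) \<partial>lborel) \<partial>P) =
    ennreal (expected_integral T F)"
proof -
  have "(\<lambda>x. indicator {0..T} (snd x) * ennreal (F (state_at (fst x) (snd x)) (action_at (fst x) (snd x))))
     \<in> borel_measurable time_path"
    by (intro borel_measurable_times_ennreal measurable_at_time_path[of "\<lambda>s a. ennreal (F s a)"]) measurable
  from lborel.nn_integral_fst[OF this]
  have "(\<integral>\<^sup>+\<omega>. (\<integral>\<^sup>+t. indicator {0..T} t * ennreal (F (state_at \<omega> t) (action_at \<omega> t)) \<partial>lborel) \<partial>P) =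
     (\<integral>\<^sup>+x. indicator {0..T} (snd x) * ennreal (F (state_at (fst x) (snd x)) (action_at (fst x) (snd x))) \<partial>time_path)"
    by simp
  also have "\<dots> = (\<integral>\<^sup>+x. ennreal (integrand T F x) \<partial>time_path)"
    by (intro nn_integral_cong) (simp add: indicator_def)
  also have "\<dots> = ennreal (expected_integral T F)"
    unfolding integral_integrand
    by (rule nn_integral_eq_integral[OF integrable_integrand]) (simp add: assms)
  finally show ?thesis .
qed

lemma expected_integral_nonneg:
  assumes "\<And>s a. F s a \<ge> 0" shows "expected_integral T F \<ge> 0"
  unfolding integral_integrand by (rule Bochner_Integration.integral_nonneg) (simp add: assms)

lemma AE_state_at_le: "AE \<omega> in P. state_at \<omega> T \<le> Smax"
  using AE_state_le by eventually_elim (simp add: state_at_def)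

lemma integrable_state_at: "integrable P (\<lambda>\<omega>. h (state_at \<omega> T) :: real)"
proof -
  obtain B where "\<And>s. s \<le> Smax \<Longrightarrow> \<bar>h s\<bar> \<le> B" using ex_bound_atMost[of Smax h] by blast
  then show ?thesis
    using AE_state_at_le[of T] measurable_at_time[of "\<lambda>s _. h s" T]
    by (intro integrable_const_bound[of _ B]) (auto elim!: eventually_mono)
qed

lemma dynkin_nonneg:
  assumes T: "T \<ge> 0" and h: "\<And>s. h s \<ge> 0"
  shows "expected_integral T (generator Smax lam nu h) = (\<integral>\<omega>. h (state_at \<omega> T) \<partial>P) - h s0"
proof -
  \<comment> \<open>\<open>?U\<close> collects the positive terms of the generator and
    \<open>?V\<close> the subtracted ones; both are nonnegative, so the \<open>ennreal\<close>
    identity translates term by term.\<close>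
  let ?U = "\<lambda>s a. up_rate Smax lam s * h (s + 1) + down_rate nu s a * h (s - 1)"
  let ?V = "\<lambda>s a. up_rate Smax lam s * h s + down_rate nu s a * h s"
  have r: "up_rate Smax lam s \<ge> 0" "down_rate nu s a \<ge> 0" for s a
    using lam nu by (auto simp: up_rate_def down_rate_def)
  have UV: "?U s a \<ge> 0" "?V s a \<ge> 0" for s a using r h by simp_all
  have U: "jump_sum Smax lam nu (\<lambda>_ y. ennreal (h y)) s a = ennreal (?U s a)"
    and V: "jump_sum Smax lam nu (\<lambda>x _. ennreal (h x)) s a = ennreal (?V s a)" for s a
    unfolding jump_sum_def using r h by (simp_all add: ennreal_mult)
  have E: "(\<integral>\<^sup>+\<omega>. ennreal (h (state_at \<omega> T)) \<partial>P) = ennreal (\<integral>\<omega>. h (state_at \<omega> T) \<partial>P)"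
    by (rule nn_integral_eq_integral[OF integrable_state_at]) (simp add: h)
  have Eh: "(\<integral>\<omega>. h (state_at \<omega> T) \<partial>P) \<ge> 0" by (rule Bochner_Integration.integral_nonneg) (simp add: h)
  have "ennreal (expected_integral T ?U) + ennreal (h s0) = ennreal (expected_integral T ?V) + ennreal (\<integral>\<omega>. h (state_at \<omega> T) \<partial>P)"
    using nn_dynkin[OF T, of "\<lambda>s. ennreal (h s)"]
    unfolding U V nn_integral_expected_integral[of ?U T, OF UV(1)] nn_integral_expected_integral[of ?V T, OF UV(2)] E .
  then have "expected_integral T ?U + h s0 = expected_integral T ?V + (\<integral>\<omega>. h (state_at \<omega> T) \<partial>P)"
    using expected_integral_nonneg[of ?U T, OF UV(1)] expected_integral_nonneg[of ?V T, OF UV(2)] Eh h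
    by (subst (asm) (1 2) ennreal_plus[symmetric]) (auto simp del: ennreal_plus)
  moreover have "generator Smax lam nu h = (\<lambda>s a. ?U s a - ?V s a)"
    by (intro ext) (simp add: generator_def algebra_simps)
  ultimately show ?thesis by (simp add: expected_integral_diff)
qed

text \<open>The generator is linear in \<open>h\<close>, so a signed \<open>h\<close> splits into
  positive and negative parts.\<close>

lemma dynkin:
  assumes T: "T \<ge> 0"
  shows "expected_integral T (generator Smax lam nu h) = (\<integral>\<omega>. h (state_at \<omega> T) \<partial>P) - h s0"
proof -
  let ?p = "\<lambda>s. max 0 (h s)" and ?m = "\<lambda>s. max 0 (- h s)"
  have h: "?p s - ?m s = h s" for s by simp
  have "generator Smax lam nu h = (\<lambda>s a. generator Smax lam nu ?p s a - generator Smax lam nu ?m s a)"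
    unfolding generator_diff[symmetric] h ..
  then have "expected_integral T (generator Smax lam nu h) =
      ((\<integral>\<omega>. ?p (state_at \<omega> T) \<partial>P) - ?p s0) - ((\<integral>\<omega>. ?m (state_at \<omega> T) \<partial>P) - ?m s0)"
    by (simp add: expected_integral_diff dynkin_nonneg[OF T])
  also have "\<dots> = (\<integral>\<omega>. ?p (state_at \<omega> T) - ?m (state_at \<omega> T) \<partial>P) - (?p s0 - ?m s0)"
    by (subst Bochner_Integration.integral_diff[OF integrable_state_at integrable_state_at]) simp
  finally show ?thesis by (simp only: h)
qed

text \<open>The bound does not grow with \<open>T\<close>, so \<open>h\<close> disappears from the
  long-run average.\<close>

lemma expected_integral_generator_bound:
  assumes "\<And>s. s \<le> Smax \<Longrightarrow> \<bar>h s\<bar> \<le> B" and "T \<ge> 0"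
  shows "\<bar>expected_integral T (generator Smax lam nu h)\<bar> \<le> 2 * B"
proof -
  have "(\<integral>\<omega>. h (state_at \<omega> T) \<partial>P) \<le> (\<integral>\<omega>. B \<partial>P)"
    using AE_state_at_le[of T] by (intro integral_mono_AE integrable_state_at) (auto elim!: eventually_mono dest: assms(1))
  moreover have "(\<integral>\<omega>. - B \<partial>P) \<le> (\<integral>\<omega>. h (state_at \<omega> T) \<partial>P)"
    using AE_state_at_le[of T] by (intro integral_mono_AE integrable_state_at) (auto elim!: eventually_mono dest!: assms(1))
  ultimately show ?thesis
    unfolding dynkin[OF assms(2)] using assms(1)[OF s0] by (simp add: prob_space)
qed

section \<open>Bounds on the average cost\<close>

lemma average_cost_eq:
  "average_cost Smax lam nu W \<pi> s0 = Limsup at_top (\<lambda>T. ereal (1 / T * expected_integral T (running_cost W)))"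
  unfolding average_cost_def expected_integral_def running_cost_def ..

text \<open>The inequality is assumed for both actions, hence it holds at every time whatever the
  policy does; integrate it and divide by \<open>T\<close>.\<close>

lemma average_cost_ge:
  assumes "\<And>s a. s \<le> Smax \<Longrightarrow> g \<le> running_cost W s a + generator Smax lam nu h s a"
  shows "ereal g \<le> average_cost Smax lam nu W \<pi> s0"
proof -
  obtain B where B: "\<And>s. s \<le> Smax \<Longrightarrow> \<bar>h s\<bar> \<le> B" using ex_bound_atMost[of Smax h] by blast
  have "g + (- 2 * B) / T \<le> 1 / T * expected_integral T (running_cost W)" if T: "T > 0" for T
  proof -
    have "g * T = expected_integral T (\<lambda>_ _. g)" using T by (simp add: expected_integral_const)
    also have "\<dots> \<le> expected_integral T (\<lambda>s a. running_cost W s a + generator Smax lam nu h s a)"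
      by (rule expected_integral_mono) (use AE_time_path_le in eventually_elim, rule assms)
    also have "\<dots> \<le> expected_integral T (running_cost W) + 2 * B"
      using expected_integral_generator_bound[of h B T, OF B] T by (simp add: expected_integral_add)
    finally have "(g * T - 2 * B) / T \<le> expected_integral T (running_cost W) / T"
      using T by (intro divide_right_mono) auto
    then show ?thesis using T by (simp add: diff_divide_distrib)
  qed
  then have "Limsup at_top (\<lambda>T::real. ereal (g + (- 2 * B) / T)) \<le> average_cost Smax lam nu W \<pi> s0"
    unfolding average_cost_eq
    by (intro Limsup_mono) (use eventually_gt_at_top[of "0::real"] in eventually_elim, simp)
  then show ?thesis using lim_imp_Limsup[OF _ tendsto_perturbed[of g "- 2 * B"]] by simp
qed

text \<open>Only the action \<open>f s\<close> is tested, and \<open>h\<close> may differ from the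
  function used for the lower bound. The final proof exploits this freedom.\<close>

lemma average_cost_le:
  assumes "\<pi> = stationary f"
    and "\<And>s. s \<le> Smax \<Longrightarrow> running_cost W s (f s) + generator Smax lam nu h s (f s) \<le> g"
  shows "average_cost Smax lam nu W \<pi> s0 \<le> ereal g"
proof -
  obtain B where B: "\<And>s. s \<le> Smax \<Longrightarrow> \<bar>h s\<bar> \<le> B" using ex_bound_atMost[of Smax h] by blast
  have AE: "AE x in time_path. action_at (fst x) (snd x) = f (state_at (fst x) (snd x))"
    using AE_action[OF assms(1)] by (rule AE_time_path)
  have "1 / T * expected_integral T (running_cost W) \<le> g + (2 * B) / T" if T: "T > 0" for T
  proof -
    have "expected_integral T (running_cost W) - 2 * B \<le> expected_integral T (\<lambda>s a. running_cost W s a + generator Smax lam nu h s a)"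
      using expected_integral_generator_bound[of h B T, OF B] T by (simp add: expected_integral_add)
    also have "\<dots> \<le> expected_integral T (\<lambda>_ _. g)"
      by (rule expected_integral_mono) (use AE_time_path_le AE in eventually_elim, simp add: assms(2))
    also have "\<dots> = g * T" using T by (simp add: expected_integral_const)
    finally show ?thesis using T by (simp add: field_simps)
  qed
  then have "average_cost Smax lam nu W \<pi> s0 \<le> Limsup at_top (\<lambda>T::real. ereal (g + (2 * B) / T))"
    unfolding average_cost_eq
    by (intro Limsup_mono) (use eventually_gt_at_top[of "0::real"] in eventually_elim, simp)
  then show ?thesis using lim_imp_Limsup[OF _ tendsto_perturbed[of g "2 * B"]] by simp
qed

end

subsection \<open>The optimality equation\<close>

text \<open>If \<open>h\<close> is the relative value function with gain \<open>g\<close>, then \<open>marginal lam nu W g s\<close> is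
  \<open>nu * s * (h s - h (s - 1))\<close>; the passive action is minimising in \<open>s\<close> iff it is at most \<open>W\<close>. The
  optimality equation in the states below \<open>Smax\<close> gives the recursion, and the one in \<open>Smax\<close> fixes \<open>g\<close>.\<close>

fun marginal :: "real \<Rightarrow> real \<Rightarrow> real \<Rightarrow> real \<Rightarrow> nat \<Rightarrow> real" where
  "marginal lam nu W g 0 = 0"
| "marginal lam nu W g (Suc k) = nu * real (Suc k) * ((g - real k + max W (marginal lam nu W g k)) / lam)"

lemma continuous_marginal: "continuous_on A (\<lambda>g. marginal lam nu W g k)"
  by (induction k) (auto intro!: continuous_intros simp: divide_inverse)

text \<open>Serves the left end of the intermediate value argument: while the maximum is
  \<open>W\<close> it cancels the gain \<open>- W\<close>, leaving a nonpositive multiple of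
  \<open>k\<close>.\<close>

lemma marginal_le:
  assumes "lam > 0" "nu > 0" "W \<ge> 0"
  shows "marginal lam nu W (- W) k \<le> W"
proof (induction k)
  case (Suc k)
  then have "marginal lam nu W (- W) (Suc k) = - (nu * real (Suc k) * (real k / lam))"
    by (simp add: max_absorb1)
  also have "\<dots> \<le> 0" using assms by simp
  finally show ?case using assms by simp
qed (use assms in simp)

text \<open>The end points \<open>- W\<close> and \<open>real Smax\<close> are the extreme values of
  the running cost. At the left one the expression is \<open>0\<close>; at the right one it is at
  least \<open>real Smax\<close> because \<open>W \<ge> 0\<close>.\<close>

lemma optimality_equation:
  assumes "lam > 0" "nu > 0" "W \<ge> 0"
  obtains g where "g + max W (marginal lam nu W g Smax) = real Smax"
proof -
  let ?F = "\<lambda>g. g + max W (marginal lam nu W g Smax)"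
  have "?F (- W) \<le> real Smax" "real Smax \<le> ?F (real Smax)"
    using marginal_le[OF assms, of Smax] assms(3) by auto
  moreover have "continuous_on {- W..real Smax} ?F"
    by (intro continuous_intros continuous_marginal)
  ultimately have "\<exists>g. - W \<le> g \<and> g \<le> real Smax \<and> ?F g = real Smax"
    using assms(3) by (intro IVT') auto
  then show ?thesis using that by blast
qed

lemma generator_sum:
  "generator Smax lam nu (\<lambda>s. \<Sum>k<s. d k) s a =
     up_rate Smax lam s * d s - of_bool a * (nu * real s * d (s - 1))"
  by (cases s) (simp_all add: generator_def down_rate_def)

theorem proposition2:
  fixes lam nu W :: real and Smax :: nat
  assumes "lam > 0" and "nu > 0" and "W \<ge> 0"
  shows "\<exists>f. threshold_type Smax f \<and> optimal Smax lam nu W (stationary f)"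
proof -
  obtain g where g: "g + max W (marginal lam nu W g Smax) = real Smax"
    using optimality_equation[OF assms] .
  define x where "x = marginal lam nu W g"
  \<comment> \<open>\<open>d s\<close> is the difference \<open>h (s + 1) - h s\<close>, obtained by
    solving the optimality equation in \<open>s\<close>. The choice of \<open>g\<close> makes
    \<open>d Smax\<close> zero, in accordance with the missing upward jump there.\<close>
  define d where "d s = (g - real s + max W (x s)) / lam" for s
  have x: "nu * real s * d (s - 1) = x s" for s
    by (cases s) (simp_all add: x_def d_def)
  have d: "lam * d s = g - real s + max W (x s)" for s
    using assms(1) by (simp add: d_def)
  have gS: "g = real Smax - max W (x Smax)" using g by (simp add: x_def)
  define R where "R = Max {s. s \<le> Smax \<and> x s \<le> W}"
  have fin: "finite {s. s \<le> Smax \<and> x s \<le> W}" by simp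
  have "0 \<in> {s. s \<le> Smax \<and> x s \<le> W}" using assms(3) by (simp add: x_def)
  then have "R \<in> {s. s \<le> Smax \<and> x s \<le> W}"
    unfolding R_def by (intro Max_in fin) blast
  then have R: "R \<le> Smax" "x R \<le> W" by auto
  have above: "x s > W" if "R < s" "s \<le> Smax" for s
    using Max_ge[OF fin, of s] that unfolding R_def[symmetric] by fastforce
  define f where "f s \<longleftrightarrow> R < s" for s
  \<comment> \<open>Below \<open>R\<close> the difference is chosen so that the passive action
    satisfies the equation exactly. At \<open>R\<close> itself \<open>d\<close> already has this
    form since \<open>x R \<le> W\<close>; hence a state above \<open>R\<close>, which uses
    \<open>s\<close> and \<open>s - 1\<close>, sees only \<open>d\<close>.\<close>
  define e where "e s = (if s < R then (g - real s + W) / lam else d s)" for s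
  have e: "lam * e s = g - real s + W" if "s \<le> R" for s
    using that d[of s] R assms(1) by (cases "s < R") (auto simp: e_def)
  have "threshold_type Smax f"
    unfolding threshold_type_def f_def using R by (intro exI[of _ "int R"]) auto
  moreover have "optimal Smax lam nu W (stationary f)"
    unfolding optimal_def
  proof (intro conjI allI impI)
    fix s0 \<pi>' assume s0: "s0 \<le> Smax" and \<pi>': "admissible \<pi>'"
    interpret f: admissible_process Smax lam nu "stationary f" s0
      using assms s0 admissible_stationary by unfold_locales
    interpret \<pi>: admissible_process Smax lam nu \<pi>' s0
      using assms s0 \<pi>' by unfold_locales
    have "average_cost Smax lam nu W (stationary f) s0 \<le> ereal g"
    proof (rule f.average_cost_le[OF refl])
      fix s assume s: "s \<le> Smax"
      show "running_cost W s (f s) + generator Smax lam nu (\<lambda>s. \<Sum>k<s. e k) s (f s) \<le> g"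
      proof (cases "s \<le> R")
        case True
        \<comment> \<open>This occurs only for \<open>R = Smax\<close>: the policy never caches, the
          top state is absorbing, and its cost rate is the gain.\<close>
        moreover have "s = Smax \<Longrightarrow> g = real s - W"
          using True gS R by (simp add: max_absorb1)
        ultimately show ?thesis using e[OF True] s
          by (auto simp: generator_sum running_cost_def f_def up_rate_def)
      next
        case False
        then have "e s = d s" "e (s - 1) = d (s - 1)" by (auto simp: e_def)
        \<comment> \<open>Above \<open>R\<close> the maximum equals \<open>x s\<close>, which the
          downward term of the active action removes.\<close>
        with False s show ?thesis using x[of s] d[of s] gS above[of s]
          by (auto simp: generator_sum running_cost_def f_def up_rate_def not_less)
      qed
    qed
    also have "ereal g \<le> average_cost Smax lam nu W \<pi>' s0"
    proof (rule \<pi>.average_cost_ge)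
      fix s a assume s: "s \<le> Smax"
      \<comment> \<open>After cancellation the slack is \<open>max W (x s) - x s\<close> for the
        active and \<open>max W (x s) - W\<close> for the passive action.\<close>
      then show "g \<le> running_cost W s a + generator Smax lam nu (\<lambda>s. \<Sum>k<s. d k) s a"
        using d[of s] x[of s] gS by (cases a) (auto simp: generator_sum running_cost_def up_rate_def)
    qed
    finally show "average_cost Smax lam nu W (stationary f) s0 \<le> average_cost Smax lam nu W \<pi>' s0" .
  qed (rule admissible_stationary)
  ultimately show ?thesis by blast
qed

end
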